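(* Let $n\in\mathbb N$ and let $M\in M(2n-1,\mathbb R)$ be a nilpotent matrix with $\Lambda(M)=(n_1,\ldots,n_k;p_1,\ldots,p_k;t)$, and let $\mathfrak g_M=\mathbb R e_0\ltimes_M\mathbb R^{2n-1}$ be the corresponding $2n$-dimensional nilpotent almost abelian Lie algebra. Then $\mathfrak g_M$ admits a symplectic structure if and only if one of the following conditions holds: (i) $t$ is odd and $p_i$ is even for all $i$ such that $n_i$ is odd; (ii) $t$ is even and there exists a unique $\ell\in\{1,\dots,k\}$ such that $n_\ell$ and $p_\ell$ are both odd.
   Context: For $A\in M(d,\mathbb R)$, $\mathfrak g_A=\mathbb R e_0\ltimes_A\mathbb R^d$ denotes the $(d+1)$-dimensional real Lie algebra $\mathbb R e_0\oplus\mathbb R^d$ with $[e_0,v]=Av$ and $[v,w]=0$ for $v,w\in\mathbb R^d$ (an almost abelian Lie algebra). A symplectic structure on a real Lie algebra $\mathfrak g$ is a non-degenerate 2-form $\omega$ on $\mathfrak g$ that is closed: $\omega([x,y],z)+\omega([y,z],x)+\omega([z,x],y)=0$ for all $x,y,z\in\mathfrak g$. $\mathcal J_n$ ($n\ge2$) is the $n\times n$ nilpotent Jordan block (ones on the subdiagonal, zeros elsewhere), $0_t$ is the $t\times t$ zero matrix, $\oplus$ denotes block-diagonal sum and $N^{\oplus p}$ the block-diagonal sum of $p$ copies of $N$. For a nonzero nilpotent matrix $M\in M(m,\mathbb R)$, $\Lambda(M)=(n_1,\ldots,n_k;p_1,\ldots,p_k;t)$ means that $M$ is conjugate to $\mathcal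 J_{n_1}^{\oplus p_1}\oplus\cdots\oplus\mathcal J_{n_k}^{\oplus p_k}\oplus 0_t$, where $k\ge1$, $n_1>\cdots>n_k\ge2$, $p_i>0$ for all $i$, $t\ge0$ and $\sum_i n_ip_i+t=m$. *)

theory Defs
  imports "Jordan_Normal_Form.Jordan_Normal_Form" "Jordan_Normal_Form.VS_Connect"
begin

text \<open>The ring multiplication and unit inherited from the module record carry no meaning here,
  as for \<^const>\<open>module_vec\<close>.\<close>

record 'g real_lie_alg = "(real, 'g) module" +
  bracket :: "'g \<Rightarrow> 'g \<Rightarrow> 'g"

locale real_lie_algebra = vectorspace "class_ring :: real ring" L
  for L :: "('g, 'm) real_lie_alg_scheme" (structure) +
  assumes bracket_closed:
      "\<lbrakk>x \<in> carrier L; y \<in> carrier L\<rbrakk> \<Longrightarrow> bracket L x y \<in> carrier L"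
    and bracket_add_left:
      "\<lbrakk>x \<in> carrier L; y \<in> carrier L; z \<in> carrier L\<rbrakk> \<Longrightarrow>
        bracket L (x \<oplus> y) z = bracket L x z \<oplus> bracket L y z"
    and bracket_add_right:
      "\<lbrakk>x \<in> carrier L; y \<in> carrier L; z \<in> carrier L\<rbrakk> \<Longrightarrow>
        bracket L x (y \<oplus> z) = bracket L x y \<oplus> bracket L x z"
    and bracket_smult_left:
      "\<lbrakk>x \<in> carrier L; y \<in> carrier L\<rbrakk> \<Longrightarrow> bracket L (c \<odot> x) y = c \<odot> bracket L x y"
    and bracket_smult_right:
      "\<lbrakk>x \<in> carrier L; y \<in> carrier L\<rbrakk> \<Longrightarrow> bracket L x (c \<odot> y) = c \<odot> bracket L x y"
    and bracket_self: "x \<in> carrier L \<Longrightarrow> bracket L x x = \<zero>"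
    and jacobi:
      "\<lbrakk>x \<in> carrier L; y \<in> carrier L; z \<in> carrier L\<rbrakk> \<Longrightarrow>
        bracket L (bracket L x y) z \<oplus> bracket L (bracket L y z) x
          \<oplus> bracket L (bracket L z x) y = \<zero>"

definition two_form :: "('g, 'm) real_lie_alg_scheme \<Rightarrow> ('g \<Rightarrow> 'g \<Rightarrow> real) \<Rightarrow> bool" where
  "two_form L \<omega> \<longleftrightarrow>
     (\<forall>x\<in>carrier L. \<forall>y\<in>carrier L. \<forall>z\<in>carrier L.
        \<omega> (x \<oplus>\<^bsub>L\<^esub> y) z = \<omega> x z + \<omega> y z \<and> \<omega> x (y \<oplus>\<^bsub>L\<^esub> z) = \<omega> x y + \<omega> x z) \<and>
     (\<forall>c. \<forall>x\<in>carrier L. \<forall>y\<in>carrier L.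
        \<omega> (c \<odot>\<^bsub>L\<^esub> x) y = c * \<omega> x y \<and> \<omega> x (c \<odot>\<^bsub>L\<^esub> y) = c * \<omega> x y) \<and>
     (\<forall>x\<in>carrier L. \<omega> x x = 0)"

definition nondegenerate_form ::
  "('g, 'm) real_lie_alg_scheme \<Rightarrow> ('g \<Rightarrow> 'g \<Rightarrow> real) \<Rightarrow> bool" where
  "nondegenerate_form L \<omega> \<longleftrightarrow>
     (\<forall>x\<in>carrier L. (\<forall>y\<in>carrier L. \<omega> x y = 0) \<longrightarrow> x = \<zero>\<^bsub>L\<^esub>)"

definition closed_form :: "('g, 'm) real_lie_alg_scheme \<Rightarrow> ('g \<Rightarrow> 'g \<Rightarrow> real) \<Rightarrow> bool" where
  "closed_form L \<omega> \<longleftrightarrow>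
     (\<forall>x\<in>carrier L. \<forall>y\<in>carrier L. \<forall>z\<in>carrier L.
        \<omega> (bracket L x y) z + \<omega> (bracket L y z) x + \<omega> (bracket L z x) y = 0)"

definition symplectic_structure ::
  "('g, 'm) real_lie_alg_scheme \<Rightarrow> ('g \<Rightarrow> 'g \<Rightarrow> real) \<Rightarrow> bool" where
  "symplectic_structure L \<omega> \<longleftrightarrow> two_form L \<omega> \<and> nondegenerate_form L \<omega> \<and> closed_form L \<omega>"

text \<open>The pair \<^term>\<open>(a, v)\<close> stands for $a e_0 + v$; the bracket is the bilinear alternating
  extension of $[e_0, v] = A v$, $[v, w] = 0$.\<close>

definition almost_abelian :: "real mat \<Rightarrow> (real \<times> real vec) real_lie_alg" where
  "almost_abelian A =
     \<lparr>carrier = UNIV \<times> carrier_vec (dim_row A),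
      mult = undefined,
      one = undefined,
      zero = (0, 0\<^sub>v (dim_row A)),
      add = (\<lambda>(a, v) (b, w). (a + b, v + w)),
      smult = (\<lambda>c (a, v). (c * a, c \<cdot>\<^sub>v v)),
      bracket = (\<lambda>(a, v) (b, w). (0, a \<cdot>\<^sub>v (A *\<^sub>v w) - b \<cdot>\<^sub>v (A *\<^sub>v v)))\<rparr>"

lemma almost_abelian_simps [simp]:
  "carrier (almost_abelian A) = UNIV \<times> carrier_vec (dim_row A)"
  "zero (almost_abelian A) = (0, 0\<^sub>v (dim_row A))"
  "add (almost_abelian A) (a, v) (b, w) = (a + b, v + w)"
  "smult (almost_abelian A) c (a, v) = (c * a, c \<cdot>\<^sub>v v)"
  "bracket (almost_abelian A) (a, v) (b, w) = (0, a \<cdot>\<^sub>v (A *\<^sub>v w) - b \<cdot>\<^sub>v (A *\<^sub>v v))"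
  by (simp_all add: almost_abelian_def)

lemma almost_abelian_real_lie_algebra:
  assumes A: "A \<in> carrier_mat d d"
  shows "real_lie_algebra (almost_abelian A)"
proof -
  have d: "dim_row A = d" using A by simp
  have Av: "A *\<^sub>v v \<in> carrier_vec d" if "v \<in> carrier_vec d" for v
    using A that by simp
  have dv: "dim_vec (A *\<^sub>v v) = d" for v using A by simp
  have units: "carrier (add_monoid (almost_abelian A)) \<subseteq> Units (add_monoid (almost_abelian A))"
  proof
    fix x assume "x \<in> carrier (add_monoid (almost_abelian A))"
    then obtain a v where x: "x = (a, v)" and v: "v \<in> carrier_vec d" by (auto simp: d)
    show "x \<in> Units (add_monoid (almost_abelian A))"
      using v unfolding x Units_def by (auto simp: d intro!: exI[of _ "-a"] bexI[of _ "-v"])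
  qed
  have vs: "vectorspace (class_ring :: real ring) (almost_abelian A)"
    by (unfold_locales; (rule units
      | force simp: d algebra_simps add_smult_distrib_vec smult_add_distrib_vec smult_smult_assoc
          intro!: comm_add_vec assoc_add_vec))
  show ?thesis
    unfolding real_lie_algebra_def real_lie_algebra_axioms_def
    apply (intro conjI vs allI impI)
    subgoal using Av by (auto simp: d)
    subgoal using A
      by (auto simp: d dv mult_add_distrib_mat_vec[OF A] algebra_simps intro!: eq_vecI)
    subgoal using A
      by (auto simp: d dv mult_add_distrib_mat_vec[OF A] algebra_simps intro!: eq_vecI)
    subgoal using A by (auto simp: d dv mult_mat_vec[OF A] algebra_simps intro!: eq_vecI)
    subgoal using A by (auto simp: d dv mult_mat_vec[OF A] algebra_simps intro!: eq_vecI)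
    subgoal using A by (auto simp: d dv intro!: eq_vecI)
    subgoal for x y z
    proof -
      assume "x \<in> carrier (almost_abelian A)" "y \<in> carrier (almost_abelian A)"
        "z \<in> carrier (almost_abelian A)"
      then obtain a u b v c w where xyz: "x = (a, u)" "y = (b, v)" "z = (c, w)"
        and uvw: "u \<in> carrier_vec d" "v \<in> carrier_vec d" "w \<in> carrier_vec d"
        by (auto simp: d)
      have lin: "A *\<^sub>v (r \<cdot>\<^sub>v (A *\<^sub>v p) - s \<cdot>\<^sub>v (A *\<^sub>v q))
          = r \<cdot>\<^sub>v (A *\<^sub>v (A *\<^sub>v p)) - s \<cdot>\<^sub>v (A *\<^sub>v (A *\<^sub>v q))"
        if "p \<in> carrier_vec d" "q \<in> carrier_vec d" for p q and r s :: real
        using that Av by (simp add: mult_minus_distrib_mat_vec[OF A] mult_mat_vec[OF A])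
      show ?thesis
        using uvw A unfolding xyz
        by (auto simp: d dv lin algebra_simps intro!: eq_vecI)
    qed
    done
qed

definition nilpotent_mat :: "real mat \<Rightarrow> bool" where
  "nilpotent_mat M \<longleftrightarrow> (\<exists>r. M ^\<^sub>m r = 0\<^sub>m (dim_row M) (dim_row M))"

text \<open>The library's \<^const>\<open>jordan_block\<close> has its ones on the superdiagonal.\<close>

definition nil_jordan_block :: "nat \<Rightarrow> real mat" where
  "nil_jordan_block n = mat n n (\<lambda>(i, j). if i = Suc j then 1 else 0)"

definition nil_jordan_form ::
  "nat \<Rightarrow> (nat \<Rightarrow> nat) \<Rightarrow> (nat \<Rightarrow> nat) \<Rightarrow> nat \<Rightarrow> real mat" where
  "nil_jordan_form k ns ps t =
     diag_block_mat
       (concat (map (\<lambda>i. replicate (ps i) (nil_jordan_block (ns i))) [1..<Suc k]) @ [0\<^sub>m t t])"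

text \<open>\<open>nil_type M k ns ps t\<close> means
  $\Lambda(M) = (n_1, \ldots, n_k; p_1, \ldots, p_k; t)$ with \<open>n\<^sub>i = ns i\<close> and \<open>p\<^sub>i = ps i\<close>;
  the values of \<open>ns\<close> and \<open>ps\<close> outside \<open>{1..k}\<close> are irrelevant.\<close>

definition nil_type ::
  "real mat \<Rightarrow> nat \<Rightarrow> (nat \<Rightarrow> nat) \<Rightarrow> (nat \<Rightarrow> nat) \<Rightarrow> nat \<Rightarrow> bool" where
  "nil_type M k ns ps t \<longleftrightarrow>
     1 \<le> k \<and>
     (\<forall>i\<in>{1..k}. \<forall>j\<in>{1..k}. i < j \<longrightarrow> ns j < ns i) \<and>
     (\<forall>i\<in>{1..k}. 2 \<le> ns i) \<and>
     (\<forall>i\<in>{1..k}. 0 < ps i) \<and>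
     (\<Sum>i=1..k. ns i * ps i) + t = dim_row M \<and>
     similar_mat M (nil_jordan_form k ns ps t)"

end

theory Submission
  imports Defs
begin

text \<open>A symplectic form on $\mathfrak g_M$ restricts to a skew form \<open>B\<close> on $\mathbb R^{2n-1}$ with
  $M^T B + B M = 0$ and one-dimensional radical, and every such \<open>B\<close> extends, so only \<open>B\<close> matters.
  For even \<open>p\<close> the form $B(M^p x, y)$ is skew on $V / \ker M^p$, of dimension $r_p = \mathrm{rk}\, M^p$.
  Its kernel is zero or a line according to whether the radical of \<open>B\<close> lies in the image of $M^p$;
  hence $r_p$ is odd exactly in the latter case, and the parity of $r_p$, for even \<open>p\<close>, can only drop
  once as \<open>p\<close> grows. The number of Jordan blocks of odd size \<open>s\<close> is congruent to
  $r_{s-1} + r_{s+1}$ modulo 2, so exactly one odd size (including size 1) has odd multiplicity.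
  Conversely, single blocks of even size and pairs of equal blocks carry non-degenerate
  invariant skew forms, and a single block of odd size carries one with one-dimensional radical.\<close>

section \<open>Kernels of skew matrices\<close>

text \<open>Comparing det of the transpose with det of \<open>- A\<close> gives det A = (-1)^n det
  A, so the determinant vanishes for odd \<open>n\<close>.\<close>

lemma skew_odd_kernel_mat:
  fixes A :: "real mat"
  assumes A: "A \<in> carrier_mat n n" and n: "odd n" and skew: "transpose_mat A = - A"
  shows "\<exists>v \<in> carrier_vec n. v \<noteq> 0\<^sub>v n \<and> A *\<^sub>v v = 0\<^sub>v n"
proof -
  have "- A = (-1) \<cdot>\<^sub>m A" by auto
  then have "det A = (-1) ^ n * det A"
    using det_transpose[OF A] det_smult[of "-1" A] A skew by simp
  then have "det A = 0" using n by simp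
  then show ?thesis using det_0_iff_vec_prod_zero_field[OF A] by blast
qed

text \<open>Enumerating \<open>I\<close> reduces this to matrices. Arbitrary index sets are wanted
  because the Gram matrices below are indexed by sets of basis positions, and the bordered matrix by
  an option type.\<close>

lemma skew_odd_kernel:
  fixes S :: "'i \<Rightarrow> 'i \<Rightarrow> real"
  assumes I: "finite I" "odd (card I)"
    and skew: "\<And>i j. i \<in> I \<Longrightarrow> j \<in> I \<Longrightarrow> S i j = - S j i"
  shows "\<exists>c. (\<exists>i\<in>I. c i \<noteq> 0) \<and> (\<forall>i\<in>I. (\<Sum>j\<in>I. S i j * c j) = 0)"
proof -
  define n where "n = card I"
  obtain h where h: "bij_betw h {0..<n} I"
    using ex_bij_betw_nat_finite[OF I(1)] unfolding n_def by blast
  define A where "A = mat n n (\<lambda>(i, j). S (h i) (h j))"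
  have A: "A \<in> carrier_mat n n" by (simp add: A_def)
  have hI: "h i \<in> I" if "i < n" for i using h that by (auto simp: bij_betw_def)
  have "transpose_mat A = - A"
    by (rule eq_matI) (auto simp: A_def intro: skew hI)
  from skew_odd_kernel_mat[OF A _ this] I(2)
  obtain v where v: "v \<in> carrier_vec n" "v \<noteq> 0\<^sub>v n" "A *\<^sub>v v = 0\<^sub>v n"
    unfolding n_def by blast
  define c where "c = (\<lambda>x. v $ (inv_into {0..<n} h x))"
  have ch: "c (h j) = v $ j" if "j < n" for j
    using h that by (simp add: c_def bij_betw_def inv_into_f_f)
  show ?thesis
  proof (intro exI conjI ballI)
    from v obtain j where "j < n" "v $ j \<noteq> 0" by (metis carrier_vecD eq_vecI index_zero_vec)
    then show "\<exists>i\<in>I. c i \<noteq> 0" using ch hI by metis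
  next
    fix x assume "x \<in> I"
    then obtain i where i: "i < n" "x = h i" using h by (auto simp: bij_betw_def)
    have "(\<Sum>y\<in>I. S x y * c y) = (\<Sum>j\<in>{0..<n}. S x (h j) * c (h j))"
      using sum.reindex_bij_betw[OF h, of "\<lambda>y. S x y * c y"] by simp
    also have "\<dots> = (A *\<^sub>v v) $ i"
      using i v(1) by (simp add: A_def scalar_prod_def ch)
    finally show "(\<Sum>y\<in>I. S x y * c y) = 0" using v(3) i by simp
  qed
qed

text \<open>If the kernel is spanned by \<open>c\<close> and \<open>card I\<close> were even, bordering \<open>S\<close> by a functional
  that does not vanish at \<open>c\<close> would give an injective skew matrix of odd size.\<close>

lemma skew_line_kernel_odd:
  fixes S :: "'i \<Rightarrow> 'i \<Rightarrow> real"
  assumes I: "finite I"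
    and skew: "\<And>i j. i \<in> I \<Longrightarrow> j \<in> I \<Longrightarrow> S i j = - S j i"
    and c: "\<And>i. i \<in> I \<Longrightarrow> (\<Sum>j\<in>I. S i j * c j) = 0"
    and k: "k \<in> I" "c k \<noteq> 0"
    and line: "\<And>x. (\<And>i. i \<in> I \<Longrightarrow> (\<Sum>j\<in>I. S i j * x j) = 0) \<Longrightarrow> \<exists>a. \<forall>i\<in>I. x i = a * c i"
  shows "odd (card I)"
proof (rule ccontr)
  assume "\<not> odd (card I)"
  define I' where "I' = insert None (Some ` I)"
  \<comment> \<open>The border row \<open>None\<close> is the coordinate functional at
    \<open>k\<close>, which is nonzero at \<open>c\<close>; the border column is its negative, so
    \<open>T\<close> stays skew.\<close>
  define T where "T = (\<lambda>x y. case x of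
      None \<Rightarrow> (case y of None \<Rightarrow> 0 | Some j \<Rightarrow> if j = k then 1 else 0)
    | Some i \<Rightarrow> (case y of None \<Rightarrow> if i = k then - 1 else 0 | Some j \<Rightarrow> S i j))"
  have fin: "finite I'" and card: "odd (card I')"
    using I \<open>\<not> odd (card I)\<close> by (auto simp: I'_def card_image)
  have sumT: "(\<Sum>y\<in>I'. f y) = f None + (\<Sum>j\<in>I. f (Some j))" for f :: "'i option \<Rightarrow> real"
    using I by (simp add: I'_def sum.reindex)
  have skewT: "T x y = - T y x" if "x \<in> I'" "y \<in> I'" for x y
    using that by (auto simp: T_def I'_def intro: skew)
  from skew_odd_kernel[of I' T, OF fin card skewT]
  obtain y where y: "\<exists>i\<in>I'. y i \<noteq> 0" "\<And>i. i \<in> I' \<Longrightarrow> (\<Sum>j\<in>I'. T i j * y j) = 0" by blast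
  define x where "x = (\<lambda>j. y (Some j))"
  have mem: "None \<in> I'" "\<And>i. i \<in> I \<Longrightarrow> Some i \<in> I'" by (auto simp: I'_def)
  have "(\<Sum>j\<in>I. (if j = k then 1 else 0) * x j) = 0"
    using y(2)[OF mem(1)] by (simp add: sumT T_def x_def)
  then have xk: "x k = 0" using I k by (simp add: if_distrib[of "\<lambda>r. r * _"] cong: if_cong)
  have Sx: "(\<Sum>j\<in>I. S i j * x j) = (if i = k then y None else 0)" if "i \<in> I" for i
    using y(2)[OF mem(2)[OF that]] by (auto simp: sumT T_def x_def)
  have Sc: "(\<Sum>i\<in>I. S i j * c i) = 0" if "j \<in> I" for j
  proof -
    have "(\<Sum>i\<in>I. S i j * c i) = (\<Sum>i\<in>I. - (S j i * c i))"
      by (rule sum.cong) (use skew[OF _ that] in auto)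
    then show ?thesis using c[OF that] by (simp add: sum_negf)
  qed
  \<comment> \<open>By skewness \<open>c\<close> also annihilates \<open>S\<close> from the left.
    Pairing \<open>S x\<close>, which is supported at \<open>k\<close> with value
    \<open>y None\<close>, with \<open>c\<close> therefore gives
    \<open>c k * y None = 0\<close>.\<close>
  have "(\<Sum>i\<in>I. c i * (\<Sum>j\<in>I. S i j * x j)) = (\<Sum>i\<in>I. \<Sum>j\<in>I. x j * (S i j * c i))"
    by (simp add: sum_distrib_left mult_ac)
  also have "\<dots> = (\<Sum>j\<in>I. x j * (\<Sum>i\<in>I. S i j * c i))"
    by (subst sum.swap) (simp add: sum_distrib_left)
  also have "\<dots> = 0" using Sc by simp
  finally have "(\<Sum>i\<in>I. c i * (if i = k then y None else 0)) = 0"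
    using Sx by (simp cong: sum.cong)
  then have y0: "y None = 0" using I k by (simp add: if_distrib[of "\<lambda>r. _ * r"] cong: if_cong)
  with Sx have "(\<Sum>j\<in>I. S i j * x j) = 0" if "i \<in> I" for i using that by simp
  \<comment> \<open>Now \<open>x\<close> lies in the kernel line and vanishes at \<open>k\<close>,
    where \<open>c\<close> does not; so \<open>x\<close>, and with it \<open>y\<close>, is
    zero.\<close>
  from line[OF this] obtain a where a: "\<forall>i\<in>I. x i = a * c i" by blast
  with xk k have "a = 0" by auto
  with a y0 y(1) show False by (auto simp: I'_def x_def)
qed

section \<open>Invariant skew forms of corank at most one\<close>

text \<open>The vector \<open>u\<close> may be zero or lie outside the kernel, so invertible
  matrices are included.\<close>

definition corank_le_1 :: "real mat \<Rightarrow> bool" where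
  "corank_le_1 B \<longleftrightarrow> (\<exists>u \<in> carrier_vec (dim_row B).
     \<forall>v \<in> carrier_vec (dim_row B). B *\<^sub>v v = 0\<^sub>v (dim_row B) \<longrightarrow> (\<exists>a. v = a \<cdot>\<^sub>v u))"

text \<open>The last equation is B(Ax, y) + B(x, Ay) = 0 in matrix form: \<open>A\<close> lies in
  the Lie algebra of the isometry group of \<open>B\<close>.\<close>

definition invariant_skew_form :: "real mat \<Rightarrow> real mat \<Rightarrow> bool" where
  "invariant_skew_form A B \<longleftrightarrow> B \<in> carrier_mat (dim_row A) (dim_row A) \<and>
     transpose_mat B = - B \<and> transpose_mat A * B + B * A = 0\<^sub>m (dim_row A) (dim_row A)"

definition admissible :: "real mat \<Rightarrow> bool" where
  "admissible A \<longleftrightarrow> (\<exists>B. invariant_skew_form A B \<and> corank_le_1 B)"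

text \<open>\<open>L j\<close> is the number of steps after which \<open>A\<close> annihilates the basis vector \<open>e\<^sub>j\<close>.
  In the proof, \<open>S q\<close> is the Gram matrix of $B(A^q x, y)$ on a complement of $\ker A^q$, and
  \<open>W q c\<close> is the image under $A^q$ of the vector with coordinates \<open>c\<close>, which embeds the kernel
  of \<open>S q\<close> into that of \<open>B\<close>.\<close>

lemma shift_invariant_parity:
  fixes A :: "real mat" and L :: "nat \<Rightarrow> nat"
  assumes A: "A \<in> carrier_mat d d"
    and A_eq: "\<And>i j. i < d \<Longrightarrow> j < d \<Longrightarrow> A $$ (i, j) = (if i = Suc j \<and> 1 < L j then 1 else 0)"
    and L: "\<And>j. j < d \<Longrightarrow> 1 < L j \<Longrightarrow> Suc j < d \<and> L (Suc j) = L j - 1"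
    and pos: "\<And>j. j < d \<Longrightarrow> 0 < L j"
    and adm: "admissible A" and p: "even p" and od: "odd (card {j. j < d \<and> p + 2 < L j})"
  shows "odd (card {j. j < d \<and> p < L j})"
proof -
  from adm A obtain B u where B: "B \<in> carrier_mat d d" and sk: "transpose_mat B = - B"
    and inv: "transpose_mat A * B + B * A = 0\<^sub>m d d"
    and u: "u \<in> carrier_vec d"
    and ker: "\<And>v. v \<in> carrier_vec d \<Longrightarrow> B *\<^sub>v v = 0\<^sub>v d \<Longrightarrow> \<exists>a. v = a \<cdot>\<^sub>v u"
    unfolding admissible_def invariant_skew_form_def corank_le_1_def by auto
  define b where "b = (\<lambda>i j. B $$ (i, j))"
  have skew: "b i j = - b j i" if "i < d" "j < d" for i j
    using arg_cong[OF sk, of "\<lambda>M. M $$ (j, i)"] that B by (simp add: b_def)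
  \<comment> \<open>Invariance evaluated on basis vectors: \<open>A\<close> sends e_j to e_{j+1} if
    \<open>1 < L j\<close> and to 0 otherwise.\<close>
  have step: "(if 1 < L i then b (Suc i) j else 0) + (if 1 < L j then b i (Suc j) else 0) = 0"
    if ij: "i < d" "j < d" for i j
  proof -
    have "(transpose_mat A * B) $$ (i, j) = (\<Sum>k\<in>{0..<d}. A $$ (k, i) * b k j)"
      using A B ij by (simp add: scalar_prod_def b_def)
    also have "\<dots> = (\<Sum>k\<in>{0..<d}. if k = Suc i then (if 1 < L i then b k j else 0) else 0)"
      by (rule sum.cong) (auto simp: A_eq ij)
    also have "\<dots> = (if 1 < L i then b (Suc i) j else 0)"
      using L[of i] ij by (auto simp: sum.delta)
    finally have 1: "(transpose_mat A * B) $$ (i, j) = (if 1 < L i then b (Suc i) j else 0)" .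
    have "(B * A) $$ (i, j) = (\<Sum>k\<in>{0..<d}. b i k * A $$ (k, j))"
      using A B ij by (simp add: scalar_prod_def b_def)
    also have "\<dots> = (\<Sum>k\<in>{0..<d}. if k = Suc j then (if 1 < L j then b i k else 0) else 0)"
      by (rule sum.cong) (auto simp: A_eq ij)
    also have "\<dots> = (if 1 < L j then b i (Suc j) else 0)"
      using L[of j] ij by (auto simp: sum.delta)
    finally have 2: "(B * A) $$ (i, j) = (if 1 < L j then b i (Suc j) else 0)" .
    show ?thesis using arg_cong[OF inv, of "\<lambda>M. M $$ (i, j)"] 1 2 A B ij by simp
  qed
  have Lp: "j + q < d \<and> L (j + q) = L j - q" if "j < d" "q < L j" for j q
    using that by (induction q) (use L in \<open>force+\<close>)
  \<comment> \<open>This is B(A^q x, y) = (-1)^q B(x, A^q y) on basis vectors; for even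
    \<open>q\<close> the sign disappears, which makes \<open>S q\<close> skew.\<close>
  have shift: "(if q < L i then b (i + q) j else 0) = (-1) ^ q * (if q < L j then b i (j + q) else 0)"
    if "i < d" "j < d" for i j q
    using that
  proof (induction q arbitrary: i)
    case 0 then show ?case using pos[of i] pos[of j] by simp
  next
    case (Suc q)
    show ?case
    proof (cases "1 < L i")
      case True
      then have Si: "Suc i < d" "L (Suc i) = L i - 1" using L Suc.prems by auto
      have "(if Suc q < L i then b (i + Suc q) j else 0)
          = (if q < L (Suc i) then b (Suc i + q) j else 0)"
        using Si True by auto
      also have "\<dots> = (-1) ^ q * (if q < L j then b (Suc i) (j + q) else 0)"
        by (rule Suc.IH) (use Si True Suc.prems in auto)
      also have "(if q < L j then b (Suc i) (j + q) else 0)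
          = (if Suc q < L j then - b i (j + Suc q) else 0)"
        using step[of i "j + q"] Lp[of j q] Suc.prems True by (auto split: if_splits)
      finally show ?thesis by simp
    next
      case False
      have "(if q < L j then if 1 < L (j + q) then b i (Suc (j + q)) else 0 else 0) = 0"
        using step[of i "j + q"] Lp[of j q] Suc.prems False by (auto split: if_splits)
      then have "(if Suc q < L j then b i (j + Suc q) else 0) = 0"
        using Lp[of j q] Suc.prems by (auto split: if_splits)
      then show ?thesis using False by auto
    qed
  qed
  \<comment> \<open>These positions index the basis vectors that A^q does not kill, so
    \<open>card (I q)\<close> is the rank of A^q.\<close>
  define I where "I = (\<lambda>q. {j. j < d \<and> q < L j})"
  have fin: "finite (I q)" for q by (simp add: I_def)
  define S where "S = (\<lambda>q i j. b i (j + q))"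
  have S_alt: "S q i j = b (i + q) j" if "i \<in> I q" "j \<in> I q" "even q" for i j q
    using shift[of i j q] that by (auto simp: S_def I_def)
  have S_skew: "S q i j = - S q j i" if "i \<in> I q" "j \<in> I q" "even q" for i j q
    using S_alt[OF that] skew[of "i + q" j] Lp[of i q] that by (auto simp: S_def I_def)
  define W where "W = (\<lambda>q c. vec d (\<lambda>i. if q \<le> i \<and> i - q \<in> I q then c (i - q) else 0 :: real))"
  have W_ix: "W q c $ (j + q) = c j" if "j \<in> I q" for q c j
    using that Lp[of j q] by (auto simp: W_def I_def)
  have BW: "(B *\<^sub>v W q c) $ i = (\<Sum>j\<in>I q. S q i j * c j)" if i: "i < d" for q c i
  proof -
    have "(B *\<^sub>v W q c) $ i = (\<Sum>k\<in>{0..<d}. b i k * W q c $ k)"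
      using B i by (simp add: scalar_prod_def b_def W_def)
    also have "\<dots> = (\<Sum>k\<in>(\<lambda>j. j + q) ` I q. b i k * W q c $ k)"
    proof (rule sum.mono_neutral_right)
      show "(\<lambda>j. j + q) ` I q \<subseteq> {0..<d}" using Lp by (auto simp: I_def)
      show "\<forall>k\<in>{0..<d} - (\<lambda>j. j + q) ` I q. b i k * W q c $ k = 0"
      proof
        fix k assume k: "k \<in> {0..<d} - (\<lambda>j. j + q) ` I q"
        then have "\<not> (q \<le> k \<and> k - q \<in> I q)" by (metis DiffE imageI le_add_diff_inverse2)
        then show "b i k * W q c $ k = 0" using k by (auto simp: W_def)
      qed
    qed simp
    also have "\<dots> = (\<Sum>j\<in>I q. S q i j * c j)"
      by (subst sum.reindex) (auto simp: W_ix S_def inj_on_def)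
    finally show ?thesis .
  qed
  have W_ker: "B *\<^sub>v W q c = 0\<^sub>v d"
    if q: "even q" and c: "\<And>i. i \<in> I q \<Longrightarrow> (\<Sum>j\<in>I q. S q i j * c j) = 0" for q c
  proof (rule eq_vecI)
    fix i assume "i < dim_vec (0\<^sub>v d :: real vec)"
    then have i: "i < d" by simp
    have "(\<Sum>j\<in>I q. S q i j * c j) = 0"
    proof (cases "i \<in> I q")
      \<comment> \<open>Rows outside \<open>I q\<close> impose no condition: there A^q kills e_i,
        and \<open>shift\<close> makes the whole row vanish.\<close>
      case False
      then have "S q i j = 0" if "j \<in> I q" for j
        using shift[of i j q] that i q by (auto simp: I_def S_def)
      then show ?thesis by simp
    qed (use c in simp)
    then show "(B *\<^sub>v W q c) $ i = 0\<^sub>v d $ i" using BW i by simp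
  qed (use B in simp)
  have W_line: "\<exists>a. W q c = a \<cdot>\<^sub>v u"
    if "even q" and c: "\<And>i. i \<in> I q \<Longrightarrow> (\<Sum>j\<in>I q. S q i j * c j) = 0" for q c
    using ker[OF _ W_ker[OF that]] by (simp add: W_def)
  from od have "odd (card (I (p + 2)))" by (simp add: I_def)
  moreover have "S (p + 2) i j = - S (p + 2) j i" if "i \<in> I (p + 2)" "j \<in> I (p + 2)" for i j
    using S_skew[OF that] p by simp
  ultimately have "\<exists>c. (\<exists>i\<in>I (p + 2). c i \<noteq> 0) \<and>
      (\<forall>i\<in>I (p + 2). (\<Sum>j\<in>I (p + 2). S (p + 2) i j * c j) = 0)"
    by (intro skew_odd_kernel fin)
  then obtain c where c: "\<exists>i\<in>I (p + 2). c i \<noteq> 0"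
    "\<And>i. i \<in> I (p + 2) \<Longrightarrow> (\<Sum>j\<in>I (p + 2). S (p + 2) i j * c j) = 0"
    by auto
  \<comment> \<open>If \<open>c\<close> holds the coordinates of a vector z, then \<open>c'\<close>
    holds those of A^2 z; so A^(p+2) z = A^p (A^2 z) yields a kernel vector already visible at level
    \<open>p\<close>.\<close>
  define c' where "c' = (\<lambda>i. if 2 \<le> i \<and> i - 2 \<in> I (p + 2) then c (i - 2) else 0)"
  have I_shift: "j + 2 \<in> I p" if "j \<in> I (p + 2)" for j
    using Lp[of j 2] that by (auto simp: I_def)
  have W_eq: "W (p + 2) c = W p c'"
  proof (rule eq_vecI)
    fix i assume "i < dim_vec (W p c')"
    then have i: "i < d" by (simp add: W_def)
    show "W (p + 2) c $ i = W p c' $ i"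
    proof (cases "p + 2 \<le> i \<and> i - (p + 2) \<in> I (p + 2)")
      case True
      then have "i - p \<in> I p" using I_shift[of "i - (p + 2)"] by (simp add: numeral_2_eq_2 Suc_diff_Suc)
      with True show ?thesis using i by (auto simp: W_def c'_def)
    qed (use i in \<open>auto simp: W_def c'_def\<close>)
  qed (simp add: W_def)
  obtain j where j: "j \<in> I (p + 2)" "c j \<noteq> 0" using c(1) by blast
  obtain a where a: "W p c' = a \<cdot>\<^sub>v u" using W_line[OF _ c(2)] p W_eq by auto
  have k: "j + 2 \<in> I p" "c' (j + 2) \<noteq> 0" using j I_shift by (auto simp: c'_def)
  \<comment> \<open>The vector \<open>W p c'\<close> is nonzero, so \<open>u\<close> itself spans
    the kernel of \<open>B\<close>, and this line lies in the image of A^p.\<close>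
  have a0: "a \<noteq> 0"
    using W_ix[OF k(1), of c'] a u k Lp[of "j+2" p] by (auto simp: I_def)
  have "odd (card (I p))"
  proof (rule skew_line_kernel_odd[of _ "S p" c' "j + 2"])
    show "finite (I p)" by (rule fin)
    show "S p i j = - S p j i" if "i \<in> I p" "j \<in> I p" for i j using S_skew that p by blast
    show "(\<Sum>j\<in>I p. S p i j * c' j) = 0" if "i \<in> I p" for i
    proof -
      have "i < d" using that by (simp add: I_def)
      moreover have "B *\<^sub>v W p c' = 0\<^sub>v d" using W_ker[OF _ c(2)] p W_eq by simp
      ultimately show ?thesis using BW[of i p c'] by simp
    qed
    show "j + 2 \<in> I p" "c' (j + 2) \<noteq> 0" by fact+
    fix x assume "\<And>i. i \<in> I p \<Longrightarrow> (\<Sum>j\<in>I p. S p i j * x j) = 0"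
    from W_line[OF p this] obtain e where e: "W p x = e \<cdot>\<^sub>v u" by blast
    \<comment> \<open>Both \<open>W p x\<close> and \<open>W p c'\<close> are multiples of
      \<open>u\<close>, and \<open>W p\<close> only moves coordinates by \<open>p\<close>; hence
      \<open>x\<close> and \<open>c'\<close> are proportional.\<close>
    have "x i = (e / a) * c' i" if "i \<in> I p" for i
    proof -
      have "e * u $ (i + p) = x i" "a * u $ (i + p) = c' i"
        using W_ix[OF that, of x] W_ix[OF that, of c'] a e u Lp[of i p] that by (auto simp: I_def)
      then show ?thesis using a0 by (metis nonzero_divide_eq_eq mult.left_commute mult.commute)
    qed
    then show "\<exists>a. \<forall>i\<in>I p. x i = a * c' i" by blast
  qed
  then show ?thesis by (simp add: I_def)
qed

section \<open>Similarity and direct sums\<close>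

lemma admissibleI:
  assumes "A \<in> carrier_mat d d" "B \<in> carrier_mat d d" "transpose_mat B = - B"
    "transpose_mat A * B + B * A = 0\<^sub>m d d" "u \<in> carrier_vec d"
    "\<And>v. v \<in> carrier_vec d \<Longrightarrow> B *\<^sub>v v = 0\<^sub>v d \<Longrightarrow> \<exists>a. v = a \<cdot>\<^sub>v u"
  shows "admissible A"
  using assms unfolding admissible_def invariant_skew_form_def corank_le_1_def
  by (intro exI[of _ B]) auto

lemma admissibleE:
  assumes "admissible A" "A \<in> carrier_mat d d"
  obtains B u where "B \<in> carrier_mat d d" "transpose_mat B = - B"
    "transpose_mat A * B + B * A = 0\<^sub>m d d" "u \<in> carrier_vec d"
    "\<And>v. v \<in> carrier_vec d \<Longrightarrow> B *\<^sub>v v = 0\<^sub>v d \<Longrightarrow> \<exists>a. v = a \<cdot>\<^sub>v u"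
  using assms unfolding admissible_def invariant_skew_form_def corank_le_1_def by auto

text \<open>The change of basis P replaces B by the congruent form P^T B P, which is again skew, is
  invariant under the conjugate matrix, and has kernel Q (ker B) with Q inverse to P.\<close>

lemma admissible_similar:
  assumes "admissible A" "similar_mat A C"
  shows "admissible C"
proof -
  from similar_matD[OF assms(2)] obtain d P Q where
    c: "A \<in> carrier_mat d d" "C \<in> carrier_mat d d" "P \<in> carrier_mat d d" "Q \<in> carrier_mat d d"
    and PQ: "P * Q = 1\<^sub>m d" and QP: "Q * P = 1\<^sub>m d" and A: "A = P * C * Q" by auto
  from admissibleE[OF assms(1) c(1)] obtain B u where
    B: "B \<in> carrier_mat d d" and sk: "transpose_mat B = - B"
    and inv: "transpose_mat A * B + B * A = 0\<^sub>m d d" and u: "u \<in> carrier_vec d"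
    and ker: "\<And>v. v \<in> carrier_vec d \<Longrightarrow> B *\<^sub>v v = 0\<^sub>v d \<Longrightarrow> \<exists>a. v = a \<cdot>\<^sub>v u" by blast
  let ?Pt = "transpose_mat P" and ?Qt = "transpose_mat Q" and ?B = "transpose_mat P * B * P"
  have AP: "A * P = P * C"
    using c QP unfolding A by (simp add: assoc_mult_mat[of _ d d _ d _ d])
  have PtAt: "?Pt * transpose_mat A = transpose_mat C * ?Pt"
    using arg_cong[OF AP, of transpose_mat] c by (simp add: transpose_mult[of _ d d _ d])
  have QtPt: "?Qt * ?Pt = 1\<^sub>m d"
    using arg_cong[OF PQ, of transpose_mat] c by (simp add: transpose_mult[of _ d d _ d])
  show ?thesis
  proof (rule admissibleI[OF c(2)])
    show "?B \<in> carrier_mat d d" using B c by auto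
    have "transpose_mat ?B = ?Pt * (transpose_mat B * P)"
      using B c by (simp add: transpose_mult[of _ d d _ d])
    also have "\<dots> = - ?B" using B c unfolding sk
      by (simp add: assoc_mult_mat[of _ d d _ d _ d])
    finally show "transpose_mat ?B = - ?B" .
    have "transpose_mat C * ?B = ?Pt * (transpose_mat A * B * P)"
    proof -
      have "transpose_mat C * ?B = transpose_mat C * ?Pt * (B * P)"
        using B c by (simp add: assoc_mult_mat[of _ d d _ d _ d])
      also have "\<dots> = ?Pt * (transpose_mat A * B * P)"
        using B c by (simp add: PtAt[symmetric] assoc_mult_mat[of _ d d _ d _ d])
      finally show ?thesis .
    qed
    moreover have "?B * C = ?Pt * (B * A * P)"
      using B c by (simp add: assoc_mult_mat[of _ d d _ d _ d] AP)
    ultimately have "transpose_mat C * ?B + ?B * C = ?Pt * ((transpose_mat A * B + B * A) * P)"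
      using B c by (simp add: add_mult_distrib_mat[of _ d d _ _ d] mult_add_distrib_mat[of _ d d _ d])
    then show "transpose_mat C * ?B + ?B * C = 0\<^sub>m d d"
      unfolding inv using c by simp
    show "Q *\<^sub>v u \<in> carrier_vec d" using c u by simp
    fix v :: "real vec" assume v: "v \<in> carrier_vec d" and "?B *\<^sub>v v = 0\<^sub>v d"
    moreover have "?Qt *\<^sub>v 0\<^sub>v d = 0\<^sub>v d" using c by (intro eq_vecI) auto
    ultimately have "?Qt *\<^sub>v (?Pt *\<^sub>v (B *\<^sub>v (P *\<^sub>v v))) = 0\<^sub>v d"
      using B c by (simp add: assoc_mult_mat_vec[of _ d d _ d])
    moreover have "?Qt *\<^sub>v (?Pt *\<^sub>v w) = w" if "w \<in> carrier_vec d" for w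
      using assoc_mult_mat_vec[of ?Qt d d ?Pt d w] c that QtPt by simp
    ultimately have "B *\<^sub>v (P *\<^sub>v v) = 0\<^sub>v d" using B c v by simp
    with ker obtain a where a: "P *\<^sub>v v = a \<cdot>\<^sub>v u" using c v by (meson mult_mat_vec_carrier)
    have "v = Q *\<^sub>v (P *\<^sub>v v)"
      using assoc_mult_mat_vec[of Q d d P d v] c v QP by simp
    also have "\<dots> = a \<cdot>\<^sub>v (Q *\<^sub>v u)" using a c u by (simp add: mult_mat_vec)
    finally show "\<exists>a. v = a \<cdot>\<^sub>v (Q *\<^sub>v u)" by blast
  qed
qed

text \<open>A nonzero kernel vector would span the kernel, and then
  \<open>skew_line_kernel_odd\<close> would make the dimension odd.\<close>

lemma even_skew_line_kernel_trivial:
  fixes B :: "real mat"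
  assumes B: "B \<in> carrier_mat d d" and sk: "transpose_mat B = - B" and d: "even d"
    and u: "u \<in> carrier_vec d"
    and ker: "\<And>v. v \<in> carrier_vec d \<Longrightarrow> B *\<^sub>v v = 0\<^sub>v d \<Longrightarrow> \<exists>a. v = a \<cdot>\<^sub>v u"
    and w: "w \<in> carrier_vec d" "B *\<^sub>v w = 0\<^sub>v d"
  shows "w = 0\<^sub>v d"
proof (rule ccontr)
  assume "w \<noteq> 0\<^sub>v d"
  with w(1) obtain k where k: "k < d" "w $ k \<noteq> 0" by (metis carrier_vecD eq_vecI index_zero_vec)
  obtain a where a: "w = a \<cdot>\<^sub>v u" using ker w by blast
  with k u have a0: "a \<noteq> 0" by auto
  have Bv: "(B *\<^sub>v v) $ i = (\<Sum>j<d. B $$ (i, j) * v $ j)" if "v \<in> carrier_vec d" "i < d" for v i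
    using that B by (simp add: scalar_prod_def atLeast0LessThan)
  have "odd (card {..<d})"
  proof (rule skew_line_kernel_odd[of _ "\<lambda>i j. B $$ (i, j)" "\<lambda>i. w $ i" k])
    show "B $$ (i, j) = - B $$ (j, i)" if "i \<in> {..<d}" "j \<in> {..<d}" for i j
      using arg_cong[OF sk, of "\<lambda>M. M $$ (j, i)"] that B by simp
    show "(\<Sum>j<d. B $$ (i, j) * w $ j) = 0" if "i \<in> {..<d}" for i
      using Bv[OF w(1), of i] w(2) that by simp
    fix x :: "nat \<Rightarrow> real"
    assume x: "\<And>i. i \<in> {..<d} \<Longrightarrow> (\<Sum>j<d. B $$ (i, j) * x j) = 0"
    have "B *\<^sub>v vec d x = 0\<^sub>v d"
    proof (rule eq_vecI)
      fix i assume "i < dim_vec (0\<^sub>v d :: real vec)"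
      then show "(B *\<^sub>v vec d x) $ i = 0\<^sub>v d $ i"
        using x[of i] by (subst Bv) auto
    qed (use B in simp)
    then obtain e where e: "vec d x = e \<cdot>\<^sub>v u" using ker vec_carrier by blast
    have "x i = e * u $ i" if "i < d" for i
      using arg_cong[OF e, of "\<lambda>v. v $ i"] that u by simp
    moreover have "w $ i = a * u $ i" if "i < d" for i
      using arg_cong[OF a, of "\<lambda>v. v $ i"] that u by simp
    ultimately have "\<forall>i\<in>{..<d}. x i = e / a * w $ i" using a0 by simp
    then show "\<exists>a. \<forall>i\<in>{..<d}. x i = a * w $ i" by (rule exI)
  qed (use k in simp_all)
  with d show False by simp
qed

lemma append_vec_zero: "0\<^sub>v m @\<^sub>v 0\<^sub>v n = 0\<^sub>v (m + n)"
  by (rule eq_vecI) auto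

text \<open>The kernel of a block sum of forms is the sum of the kernels. The form on an
  even-dimensional summand has trivial kernel, so at most one line remains.\<close>

lemma admissible_four_block:
  assumes A: "A \<in> carrier_mat m m" and C: "C \<in> carrier_mat n n"
    and adm: "admissible A" "admissible C" and ev: "even m \<or> even n"
  shows "admissible (four_block_mat A (0\<^sub>m m n) (0\<^sub>m n m) C)"
proof -
  from admissibleE[OF adm(1) A] obtain B u where
    B: "B \<in> carrier_mat m m" and skB: "transpose_mat B = - B"
    and invB: "transpose_mat A * B + B * A = 0\<^sub>m m m" and u: "u \<in> carrier_vec m"
    and kerB: "\<And>v. v \<in> carrier_vec m \<Longrightarrow> B *\<^sub>v v = 0\<^sub>v m \<Longrightarrow> \<exists>a. v = a \<cdot>\<^sub>v u" by blast
  from admissibleE[OF adm(2) C] obtain D w where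
    D: "D \<in> carrier_mat n n" and skD: "transpose_mat D = - D"
    and invD: "transpose_mat C * D + D * C = 0\<^sub>m n n" and w: "w \<in> carrier_vec n"
    and kerD: "\<And>v. v \<in> carrier_vec n \<Longrightarrow> D *\<^sub>v v = 0\<^sub>v n \<Longrightarrow> \<exists>a. v = a \<cdot>\<^sub>v w" by blast
  let ?F = "\<lambda>X Y. four_block_mat X (0\<^sub>m m n) (0\<^sub>m n m) Y"
  \<comment> \<open>The line comes from the second block if \<open>m\<close> is even, and otherwise
    from the first, where \<open>n\<close> must be even.\<close>
  define x where "x = (if even m then 0\<^sub>v m @\<^sub>v w else u @\<^sub>v 0\<^sub>v n)"
  show ?thesis
  proof (rule admissibleI)
    show "?F A C \<in> carrier_mat (m + n) (m + n)" "?F B D \<in> carrier_mat (m + n) (m + n)"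
      using A B C D by auto
    show "x \<in> carrier_vec (m + n)" using u w by (auto simp: x_def)
    have "transpose_mat (?F B D) = ?F (- B) (- D)"
      using B D by (subst transpose_four_block_mat[of _ m m _ n _ n]) (auto simp: skB skD)
    also have "\<dots> = - ?F B D"
      using B D by (intro eq_matI) auto
    finally show "transpose_mat (?F B D) = - ?F B D" .
    have "transpose_mat (?F A C) * ?F B D + ?F B D * ?F A C
        = ?F (transpose_mat A * B + B * A) (transpose_mat C * D + D * C)"
      using A B C D
      by (simp add: transpose_four_block_mat[of _ m m _ n _ n]
          mult_four_block_mat[of _ m m _ n _ n _ _ m _ n] add_four_block_mat[of _ m m _ n _ n])
    then show "transpose_mat (?F A C) * ?F B D + ?F B D * ?F A C = 0\<^sub>m (m + n) (m + n)"
      by (simp add: invB invD)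
    fix v :: "real vec" assume v: "v \<in> carrier_vec (m + n)" and Fv: "?F B D *\<^sub>v v = 0\<^sub>v (m + n)"
    define p q where "p = vec_first v m" and "q = vec_last v n"
    have pq: "p \<in> carrier_vec m" "q \<in> carrier_vec n" "v = p @\<^sub>v q"
      using v by (simp_all add: p_def q_def)
    have "B *\<^sub>v p @\<^sub>v D *\<^sub>v q = 0\<^sub>v m @\<^sub>v 0\<^sub>v n"
      using mult_mat_vec_split[OF B D pq(1,2)] Fv pq(3) by (simp add: append_vec_zero)
    then have Bp: "B *\<^sub>v p = 0\<^sub>v m" and Dq: "D *\<^sub>v q = 0\<^sub>v n"
      using append_vec_eq[THEN iffD1, of "B *\<^sub>v p" m "0\<^sub>v m" "D *\<^sub>v q" "0\<^sub>v n"]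
        mult_mat_vec_carrier[OF B pq(1)] zero_carrier_vec by blast+
    show "\<exists>a. v = a \<cdot>\<^sub>v x"
    proof (cases "even m")
      case True
      have "p = 0\<^sub>v m" by (rule even_skew_line_kernel_trivial[OF B skB True u kerB pq(1) Bp])
      moreover obtain a where "q = a \<cdot>\<^sub>v w" using kerD pq Dq by blast
      ultimately have "v = a \<cdot>\<^sub>v x" using True w pq by (intro eq_vecI) (auto simp: x_def)
      then show ?thesis ..
    next
      case False
      with ev have "q = 0\<^sub>v n" using even_skew_line_kernel_trivial[OF D skD _ w kerD pq(2) Dq] by blast
      moreover obtain a where "p = a \<cdot>\<^sub>v u" using kerB pq Bp by blast
      ultimately have "v = a \<cdot>\<^sub>v x" using False u pq by (intro eq_vecI) (auto simp: x_def)
      then show ?thesis ..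
    qed
  qed
qed

section \<open>Direct sums of Jordan blocks\<close>

text \<open>A block of size 1 is the zero matrix, so a single list of sizes can also record the
  summand 0_t.\<close>

definition jordan_sum :: "nat list \<Rightarrow> real mat" where
  "jordan_sum ms = diag_block_mat (map nil_jordan_block ms)"

lemma nil_jordan_block_carrier [simp]:
  "nil_jordan_block m \<in> carrier_mat m m"
  "dim_row (nil_jordan_block m) = m" "dim_col (nil_jordan_block m) = m"
  by (simp_all add: nil_jordan_block_def)

lemma jordan_sum_carrier: "jordan_sum ms \<in> carrier_mat (sum_list ms) (sum_list ms)"
  by (intro carrier_matI) (simp_all add: jordan_sum_def dim_diag_block_mat comp_def)

lemma jordan_sum_dim [simp]:
  "dim_row (jordan_sum ms) = sum_list ms" "dim_col (jordan_sum ms) = sum_list ms"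
  using jordan_sum_carrier[of ms] by simp_all

lemma jordan_sum_append:
  "jordan_sum (ms @ ns) = four_block_mat (jordan_sum ms) (0\<^sub>m (sum_list ms) (sum_list ns))
     (0\<^sub>m (sum_list ns) (sum_list ms)) (jordan_sum ns)"
  using jordan_sum_dim[of ms] jordan_sum_dim[of ns]
  unfolding jordan_sum_def by (simp add: diag_block_mat_append Let_def)

lemma jordan_sum_single: "jordan_sum [m] = nil_jordan_block m"
  unfolding jordan_sum_def list.map by (rule diag_block_mat_singleton)

text \<open>The entries of \<open>heights\<close> are the values \<open>L j\<close> of \<open>shift_invariant_parity\<close>.\<close>

definition heights :: "nat list \<Rightarrow> nat list" where
  "heights ms = concat (map (\<lambda>m. rev [1..<Suc m]) ms)"

lemma heights_simps [simp]: "heights [] = []" "heights (m # ms) = rev [1..<Suc m] @ heights ms"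
  by (simp_all add: heights_def)

lemma length_heights [simp]: "length (heights ms) = sum_list ms"
  by (induction ms) auto

lemma heights_pos: "j < sum_list ms \<Longrightarrow> 0 < heights ms ! j"
proof -
  assume "j < sum_list ms"
  then have "heights ms ! j \<in> set (heights ms)" by simp
  then show ?thesis by (auto simp: heights_def)
qed

lemma nth_heights_Cons:
  "heights (m # ms) ! j = (if j < m then m - j else heights ms ! (j - m))"
  by (simp add: nth_append rev_nth Suc_diff_Suc del: upt_Suc)

lemma heights_step:
  "j < sum_list ms \<Longrightarrow> 1 < heights ms ! j \<Longrightarrow>
     Suc j < sum_list ms \<and> heights ms ! Suc j = heights ms ! j - 1"
proof (induction ms arbitrary: j)
  case (Cons m ms)
  show ?case
  proof (cases "j < m")
    case True
    then show ?thesis using Cons.prems unfolding nth_heights_Cons by auto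
  next
    case False
    then have "Suc (j - m) < sum_list ms \<and> heights ms ! Suc (j - m) = heights ms ! (j - m) - 1"
      using Cons.prems unfolding nth_heights_Cons by (intro Cons.IH) auto
    then show ?thesis using False unfolding nth_heights_Cons by (auto simp: Suc_diff_le)
  qed
qed simp

lemma jordan_sum_index:
  "i < sum_list ms \<Longrightarrow> j < sum_list ms \<Longrightarrow>
     jordan_sum ms $$ (i, j) = (if i = Suc j \<and> 1 < heights ms ! j then 1 else 0)"
proof (induction ms arbitrary: i j)
  case (Cons m ms)
  have J: "jordan_sum (m # ms) = four_block_mat (nil_jordan_block m) (0\<^sub>m m (sum_list ms))
     (0\<^sub>m (sum_list ms) m) (jordan_sum ms)"
    using jordan_sum_append[of "[m]" ms] by (simp add: jordan_sum_single)
  show ?case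
    using Cons.prems Cons.IH[of "i - m" "j - m"] unfolding J nth_heights_Cons
    by (auto simp: nil_jordan_block_def)
qed simp

section \<open>Ranks of powers and parities of block multiplicities\<close>

lemma card_nth_eq_length_filter:
  "card {j. j < length xs \<and> P (xs ! j)} = length (filter P xs)"
  by (simp add: length_filter_conv_card)

text \<open>A block of size \<open>m\<close> has heights m, ..., 1, of which \<open>m - p\<close>
  (truncated) exceed \<open>p\<close>. The sum is the rank of the p-th power of
  \<open>jordan_sum ms\<close>.\<close>

lemma length_filter_heights:
  "length (filter ((<) p) (heights ms)) = (\<Sum>m\<leftarrow>ms. m - p)"
proof (induction ms)
  case (Cons m ms)
  have "length (filter ((<) p) [1..<Suc m]) = card {x \<in> {1..<Suc m}. p < x}"
    using distinct_length_filter[of "[1..<Suc m]"] by (simp add: Int_def conj_commute del: upt_Suc)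
  also have "{x \<in> {1..<Suc m}. p < x} = {Suc p..m}" by auto
  finally show ?case using Cons by (simp add: rev_filter[symmetric] del: upt_Suc)
qed simp

text \<open>The truncated difference, as a function of its subtrahend, is piecewise linear with one
  kink at \<open>m\<close>, so its second difference at \<open>s\<close> is the indicator of
  \<open>m = s\<close>. Writing it with additions avoids truncation.\<close>

lemma count_list_second_difference:
  fixes ms :: "nat list"
  assumes "1 \<le> s"
  shows "count_list ms s + 2 * (\<Sum>m\<leftarrow>ms. m - s) = (\<Sum>m\<leftarrow>ms. m - (s - 1)) + (\<Sum>m\<leftarrow>ms. m - (s + 1))"
  by (induction ms) (use assms in auto)

lemma admissible_rank_parity:
  assumes "admissible (jordan_sum ms)" "even p" "odd (\<Sum>m\<leftarrow>ms. m - (p + 2))"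
  shows "odd (\<Sum>m\<leftarrow>ms. m - p)"
proof -
  have card: "card {j. j < sum_list ms \<and> q < heights ms ! j} = (\<Sum>m\<leftarrow>ms. m - q)" for q
    using card_nth_eq_length_filter[of "heights ms" "(<) q"] by (simp add: length_filter_heights)
  have "odd (card {j. j < sum_list ms \<and> p < heights ms ! j})"
    by (rule shift_invariant_parity[OF jordan_sum_carrier[of ms] jordan_sum_index])
      (use assms heights_step heights_pos card in auto)
  then show ?thesis using card by simp
qed

lemma admissible_odd_count_unique:
  assumes adm: "admissible (jordan_sum ms)"
    and "odd s" "odd (count_list ms s)" "odd s'" "odd (count_list ms s')"
  shows "s = s'"
proof -
  define r where "r = (\<lambda>p. \<Sum>m\<leftarrow>ms. m - p)"
  have desc: "odd (r p)" if "even p" "odd (r (p + 2 * e))" for p e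
    using that
  proof (induction e)
    case (Suc e)
    then show ?case
      using admissible_rank_parity[OF adm, of "p + 2 * e"] by (auto simp: r_def)
  qed simp
  \<comment> \<open>An odd multiplicity makes the ranks at \<open>q - 1\<close> and
    \<open>q + 1\<close> differ in parity, and \<open>desc\<close> excludes that the later one is
    odd.\<close>
  have par: "odd (r (q - 1)) \<and> even (r (q + 1))" if "odd q" "odd (count_list ms q)" for q
  proof -
    have q: "1 \<le> q" using that by (cases q) auto
    have "odd (r (q - 1) + r (q + 1))"
      using count_list_second_difference[OF q, of ms] that unfolding r_def
      by (metis dvd_triv_left even_add)
    moreover have "odd (r (q - 1))" if "odd (r (q + 1))"
      using desc[of "q - 1" 1] that q \<open>odd q\<close> by simp
    ultimately show ?thesis by auto
  qed
  \<comment> \<open>Since \<open>a + 1\<close> and \<open>b - 1\<close> are even with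
    \<open>a + 1 \<le> b - 1\<close>, oddness of \<open>r (b - 1)\<close> descends to
    \<open>r (a + 1)\<close>, against \<open>par\<close> at \<open>a\<close>.\<close>
  have False if "odd a" "odd (count_list ms a)" "odd b" "odd (count_list ms b)" "a < b" for a b
  proof -
    obtain i j where "a = 2 * i + 1" "b = 2 * j + 1" using \<open>odd a\<close> \<open>odd b\<close> by (elim oddE)
    with \<open>a < b\<close> have e: "b = a + 2 * (j - i)" by simp
    with \<open>a < b\<close> obtain e' where "j - i = Suc e'" by (cases "j - i") auto
    with e have "b - 1 = (a + 1) + 2 * e'" by simp
    then have "odd (r (a + 1))"
      using desc[of "a + 1" e'] par[OF \<open>odd b\<close> \<open>odd (count_list ms b)\<close>] \<open>odd a\<close> by simp
    then show False using par[OF \<open>odd a\<close> \<open>odd (count_list ms a)\<close>] by blast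
  qed
  then have "\<not> s < s'" "\<not> s' < s" using assms by blast+
  then show ?thesis by simp
qed

section \<open>Construction of invariant forms\<close>

text \<open>Invertible for \<open>c = 0\<close>; for \<open>c = 1\<close> the kernel is spanned by the last basis vector.\<close>

definition alt_antidiag :: "nat \<Rightarrow> nat \<Rightarrow> real mat" where
  "alt_antidiag c m = mat m m (\<lambda>(i, j). if i + j + c + 1 = m then (-1) ^ i else 0)"

lemma alt_antidiag_carrier [simp]:
  "alt_antidiag c m \<in> carrier_mat m m" "dim_row (alt_antidiag c m) = m"
  "dim_col (alt_antidiag c m) = m"
  by (simp_all add: alt_antidiag_def)

text \<open>Shifting the row index or the column index by one leads to the same antidiagonal i + j +
  c + 2 = m; the alternating signs there are opposite and cancel.\<close>

lemma alt_antidiag_invariant: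
  "transpose_mat (nil_jordan_block m) * alt_antidiag c m + alt_antidiag c m * nil_jordan_block m
    = 0\<^sub>m m m"
proof (rule eq_matI)
  fix i j assume "i < dim_row (0\<^sub>m m m :: real mat)" "j < dim_col (0\<^sub>m m m :: real mat)"
  then have ij: "i < m" "j < m" by simp_all
  let ?J = "nil_jordan_block m" and ?K = "alt_antidiag c m"
  have "(transpose_mat ?J * ?K) $$ (i, j) = (\<Sum>k\<in>{0..<m}. ?J $$ (k, i) * ?K $$ (k, j))"
    using ij by (simp add: scalar_prod_def)
  also have "\<dots> = (\<Sum>k\<in>{0..<m}. if k = Suc i then ?K $$ (k, j) else 0)"
    by (rule sum.cong) (use ij in \<open>auto simp: nil_jordan_block_def\<close>)
  also have "\<dots> = (if i + j + c + 2 = m then - ((-1) ^ i) else 0)"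
    using ij by (auto simp: sum.delta alt_antidiag_def)
  finally have 1: "(transpose_mat ?J * ?K) $$ (i, j) = (if i + j + c + 2 = m then - ((-1) ^ i) else 0)" .
  have "(?K * ?J) $$ (i, j) = (\<Sum>k\<in>{0..<m}. ?K $$ (i, k) * ?J $$ (k, j))"
    using ij by (simp add: scalar_prod_def)
  also have "\<dots> = (\<Sum>k\<in>{0..<m}. if k = Suc j then ?K $$ (i, k) else 0)"
    by (rule sum.cong) (use ij in \<open>auto simp: nil_jordan_block_def\<close>)
  also have "\<dots> = (if i + j + c + 2 = m then (-1) ^ i else 0)"
    using ij by (auto simp: sum.delta alt_antidiag_def)
  finally have 2: "(?K * ?J) $$ (i, j) = (if i + j + c + 2 = m then (-1) ^ i else 0)" .
  show "(transpose_mat ?J * ?K + ?K * ?J) $$ (i, j) = 0\<^sub>m m m $$ (i, j)"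
    using ij 1 2 by simp
qed simp_all

text \<open>Row m - 1 - c - k has its only nonzero entry in column \<open>k\<close>.\<close>

lemma alt_antidiag_kernel:
  assumes v: "v \<in> carrier_vec m" and Kv: "alt_antidiag c m *\<^sub>v v = 0\<^sub>v m" and k: "k + c < m"
  shows "v $ k = 0"
proof -
  let ?i = "m - 1 - c - k"
  have i: "?i < m" using k by simp
  have "0 = (alt_antidiag c m *\<^sub>v v) $ ?i" using Kv i by simp
  also have "\<dots> = (\<Sum>j\<in>{0..<m}. alt_antidiag c m $$ (?i, j) * v $ j)"
    using v i by (simp add: scalar_prod_def)
  also have "\<dots> = (\<Sum>j\<in>{0..<m}. if j = k then (-1) ^ ?i * v $ j else 0)"
    by (rule sum.cong) (use k in \<open>auto simp: alt_antidiag_def\<close>)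
  also have "\<dots> = (-1) ^ ?i * v $ k" using k by simp
  finally show ?thesis by simp
qed

lemma admissible_nil_jordan_block: "admissible (nil_jordan_block m)"
proof -
  \<comment> \<open>With this choice i + j is odd on the support, so the alternating signs make the
    matrix skew rather than symmetric.\<close>
  define c :: nat where "c = (if even m then 0 else 1)"
  show ?thesis
  proof (rule admissibleI)
    show "transpose_mat (alt_antidiag c m) = - alt_antidiag c m"
    proof (rule eq_matI)
      fix i j assume "i < dim_row (- alt_antidiag c m)" "j < dim_col (- alt_antidiag c m)"
      moreover have "(-1) ^ j = (- ((-1) ^ i) :: real)" if "i + j + c + 1 = m"
      proof -
        have "odd (i + j)" using that by (auto simp: c_def split: if_splits)
        then show ?thesis by (cases "even i") auto
      qed
      ultimately show "transpose_mat (alt_antidiag c m) $$ (i, j) = (- alt_antidiag c m) $$ (i, j)"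
        by (auto simp: alt_antidiag_def add.commute)
    qed simp_all
    show "unit_vec m (m - 1) \<in> carrier_vec m" by simp
    fix v :: "real vec" assume v: "v \<in> carrier_vec m" and "alt_antidiag c m *\<^sub>v v = 0\<^sub>v m"
    then have z: "v $ k = 0" if "k + 1 < m" for k
      using alt_antidiag_kernel[OF v, of c k] that by (auto simp: c_def split: if_splits)
    have "v = v $ (m - 1) \<cdot>\<^sub>v unit_vec m (m - 1)"
    proof (rule eq_vecI)
      fix k assume "k < dim_vec (v $ (m - 1) \<cdot>\<^sub>v unit_vec m (m - 1))"
      then have "k < m" by simp
      then show "v $ k = (v $ (m - 1) \<cdot>\<^sub>v unit_vec m (m - 1)) $ k"
        using z[of k] by (cases "k = m - 1") auto
    qed (use v in simp)
    then show "\<exists>a. v = a \<cdot>\<^sub>v unit_vec m (m - 1)" ..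
  qed (simp_all add: alt_antidiag_invariant)
qed

text \<open>For odd \<open>m\<close> the invertible antidiagonal form K is symmetric. Placing K and
  -K off the diagonal turns it into an invertible skew form on two copies.\<close>

lemma admissible_odd_pair:
  assumes m: "odd m"
  shows "admissible (jordan_sum [m, m])"
proof -
  let ?J = "nil_jordan_block m" and ?Z = "0\<^sub>m m m :: real mat"
  define K where "K = alt_antidiag 0 m"
  have K: "K \<in> carrier_mat m m" by (simp add: K_def)
  have inv: "transpose_mat ?J * K + K * ?J = ?Z"
    unfolding K_def by (rule alt_antidiag_invariant)
  have sym: "transpose_mat K = K"
  proof (rule eq_matI)
    fix i j assume "i < dim_row K" "j < dim_col K"
    moreover have "(-1) ^ j = ((-1) ^ i :: real)" if "i + j + 1 = m"
    proof -
      have "even (i + j)" using that m by auto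
      then show ?thesis by (cases "even i") auto
    qed
    ultimately show "transpose_mat K $$ (i, j) = K $$ (i, j)"
      by (auto simp: K_def alt_antidiag_def add.commute)
  qed (use K in simp_all)
  have J: "jordan_sum [m, m] = four_block_mat ?J ?Z ?Z ?J"
    using jordan_sum_append[of "[m]" "[m]"] by (simp add: jordan_sum_single)
  let ?B = "four_block_mat ?Z K (- K) ?Z"
  show ?thesis unfolding J
  proof (rule admissibleI)
    show "four_block_mat ?J ?Z ?Z ?J \<in> carrier_mat (m + m) (m + m)" "?B \<in> carrier_mat (m + m) (m + m)"
      using K by auto
    have "transpose_mat ?B = four_block_mat ?Z (- K) K ?Z"
      using K by (subst transpose_four_block_mat[of _ m m _ m _ m]) (auto simp: sym transpose_uminus)
    also have "\<dots> = - ?B" using K by (intro eq_matI) auto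
    finally show "transpose_mat ?B = - ?B" .
    have Z: "- ?Z = ?Z" by (intro eq_matI) auto
    have JK: "transpose_mat ?J * K \<in> carrier_mat m m" "K * ?J \<in> carrier_mat m m"
      using K by auto
    have "transpose_mat (four_block_mat ?J ?Z ?Z ?J) * ?B
        = four_block_mat ?Z (transpose_mat ?J * K) (- (transpose_mat ?J * K)) ?Z"
      using K JK
      by (simp add: transpose_four_block_mat[of _ m m _ m _ m]
          mult_four_block_mat[of _ m m _ m _ m _ _ m _ m] Z)
    moreover have "?B * four_block_mat ?J ?Z ?Z ?J
        = four_block_mat ?Z (K * ?J) (- (K * ?J)) ?Z"
      using K JK by (simp add: mult_four_block_mat[of _ m m _ m _ m _ _ m _ m] Z)
    moreover have neg: "- (transpose_mat ?J * K + K * ?J) = - (transpose_mat ?J * K) + - (K * ?J)"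
      unfolding uminus_add_mat[OF JK] by (rule comm_add_mat[of _ m m]) (use JK in auto)
    ultimately have "transpose_mat (four_block_mat ?J ?Z ?Z ?J) * ?B + ?B * four_block_mat ?J ?Z ?Z ?J
        = four_block_mat ?Z (transpose_mat ?J * K + K * ?J) (- (transpose_mat ?J * K + K * ?J)) ?Z"
      using JK neg by (simp add: add_four_block_mat[of _ m m _ m _ m])
    also have "\<dots> = 0\<^sub>m (m + m) (m + m)" unfolding inv by (intro eq_matI) auto
    finally show "transpose_mat (four_block_mat ?J ?Z ?Z ?J) * ?B + ?B * four_block_mat ?J ?Z ?Z ?J
        = 0\<^sub>m (m + m) (m + m)" .
    show "0\<^sub>v (m + m) \<in> carrier_vec (m + m)" by simp
    fix v :: "real vec" assume v: "v \<in> carrier_vec (m + m)" and Bv: "?B *\<^sub>v v = 0\<^sub>v (m + m)"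
    define p q where "p = vec_first v m" and "q = vec_last v m"
    have pq: "p \<in> carrier_vec m" "q \<in> carrier_vec m" "v = p @\<^sub>v q"
      using v by (simp_all add: p_def q_def)
    have "?B *\<^sub>v v = (?Z *\<^sub>v p + K *\<^sub>v q) @\<^sub>v (- K *\<^sub>v p + ?Z *\<^sub>v q)"
      unfolding pq(3) using K pq by (intro four_block_mat_mult_vec) auto
    also have "?Z *\<^sub>v p + K *\<^sub>v q = K *\<^sub>v q" using K pq by (intro eq_vecI) auto
    also have "- K *\<^sub>v p + ?Z *\<^sub>v q = - (K *\<^sub>v p)" using K pq by (intro eq_vecI) auto
    finally have "K *\<^sub>v q @\<^sub>v - (K *\<^sub>v p) = 0\<^sub>v m @\<^sub>v 0\<^sub>v m" using Bv by (simp add: append_vec_zero)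
    then have Kq: "K *\<^sub>v q = 0\<^sub>v m" and "- (K *\<^sub>v p) = 0\<^sub>v m"
      using append_vec_eq[THEN iffD1, of "K *\<^sub>v q" m "0\<^sub>v m" "- (K *\<^sub>v p)" "0\<^sub>v m"]
        mult_mat_vec_carrier[OF K pq(2)] zero_carrier_vec by blast+
    then have Kp: "K *\<^sub>v p = 0\<^sub>v m"
      using K pq by (metis mult_mat_vec_carrier uminus_zero_vec_eq)
    have "p = 0\<^sub>v m" "q = 0\<^sub>v m"
      using alt_antidiag_kernel[OF pq(1) Kp[unfolded K_def]]
        alt_antidiag_kernel[OF pq(2) Kq[unfolded K_def]] pq by (auto intro!: eq_vecI)
    then show "\<exists>a. v = a \<cdot>\<^sub>v 0\<^sub>v (m + m)" unfolding pq(3)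
      by (intro exI[of _ 0]) (auto intro!: eq_vecI)
  qed
qed

section \<open>Assembling forms on sums of many blocks\<close>

lemma admissible_append:
  assumes "admissible (jordan_sum ms)" "admissible (jordan_sum ns)"
    and "even (sum_list ms) \<or> even (sum_list ns)"
  shows "admissible (jordan_sum (ms @ ns))"
  unfolding jordan_sum_append
  by (rule admissible_four_block[OF jordan_sum_carrier jordan_sum_carrier assms])

lemma admissible_Nil: "admissible (jordan_sum [])"
proof (rule admissibleI)
  show "\<exists>a. v = a \<cdot>\<^sub>v 0\<^sub>v 0" if "v \<in> carrier_vec 0" for v :: "real vec"
    using that by (intro exI[of _ 0] eq_vecI) auto
qed (auto simp: jordan_sum_def)

lemma admissible_single: "admissible (jordan_sum [m])"
  unfolding jordan_sum_single by (rule admissible_nil_jordan_block)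

lemma admissible_replicate_even: "admissible (jordan_sum (replicate (2 * q) m))"
proof (induction q)
  case (Suc q)
  \<comment> \<open>Odd \<open>m\<close> needs the paired form; for even \<open>m\<close> two
    single-block forms can be added.\<close>
  have "admissible (jordan_sum [m, m])"
    using admissible_odd_pair admissible_append[OF admissible_single admissible_single, of m m] by auto
  then have "admissible (jordan_sum ([m, m] @ replicate (2 * q) m))"
    using Suc by (intro admissible_append) auto
  then show ?case by simp
qed (simp add: admissible_Nil)

lemma admissible_replicate: "admissible (jordan_sum (replicate p m))"
proof (cases "even p")
  case True
  then show ?thesis using admissible_replicate_even by (elim evenE) simp
next
  case False
  then obtain q where p: "p = Suc (2 * q)" by (elim oddE) simp
  have "admissible (jordan_sum ([m] @ replicate (2 * q) m))"
    using admissible_single admissible_replicate_even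
    by (rule admissible_append) (simp add: sum_list_replicate)
  then show ?thesis by (simp add: p)
qed

text \<open>When the first list is split off, it or the rest has even total size, as
  \<open>admissible_append\<close> requires.\<close>

lemma admissible_concat:
  assumes "\<forall>ms \<in> set mss. admissible (jordan_sum ms)"
    and "length (filter (\<lambda>ms. odd (sum_list ms)) mss) \<le> 1"
  shows "admissible (jordan_sum (concat mss))"
  using assms
proof (induction mss)
  case (Cons ms mss)
  have "even (sum_list (concat mss))" if "odd (sum_list ms)"
  proof -
    have "filter (\<lambda>ms. odd (sum_list ms)) mss = []" using Cons.prems(2) that by simp
    then have "\<forall>ns \<in> set mss. even (sum_list ns)" by (simp add: filter_empty_conv)
    then show ?thesis by (induction mss) auto
  qed
  moreover have "admissible (jordan_sum (concat mss))"
    using Cons by (auto split: if_splits)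
  ultimately have "admissible (jordan_sum (ms @ concat mss))"
    using Cons.prems(1) by (intro admissible_append) auto
  then show ?case by simp
qed (simp add: admissible_Nil)

section \<open>Symplectic forms on almost abelian Lie algebras\<close>

lemma linear_vec_sum:
  fixes f :: "real vec \<Rightarrow> real"
  assumes add: "\<And>x y. x \<in> carrier_vec d \<Longrightarrow> y \<in> carrier_vec d \<Longrightarrow> f (x + y) = f x + f y"
    and smult: "\<And>c x. x \<in> carrier_vec d \<Longrightarrow> f (c \<cdot>\<^sub>v x) = c * f x"
    and v: "v \<in> carrier_vec d"
  shows "f v = (\<Sum>i<d. v $ i * f (unit_vec d i))"
proof -
  \<comment> \<open>Truncations of \<open>v\<close> to its first \<open>k\<close> coordinates, so
    that binary additivity suffices for an induction.\<close>
  define w where "w = (\<lambda>k. vec d (\<lambda>i. if i < k then v $ i else 0))"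
  have wc: "w k \<in> carrier_vec d" for k by (simp add: w_def)
  have "f (w k) = (\<Sum>i<k. v $ i * f (unit_vec d i))" if "k \<le> d" for k
    using that
  proof (induction k)
    case 0
    have "w 0 = 0 \<cdot>\<^sub>v w 0" by (intro eq_vecI) (auto simp: w_def)
    then have "f (w 0) = 0" using smult[OF wc, of 0 0] by simp
    then show ?case by simp
  next
    case (Suc k)
    have "w (Suc k) = w k + v $ k \<cdot>\<^sub>v unit_vec d k"
      using Suc.prems by (intro eq_vecI) (auto simp: w_def less_Suc_eq)
    then have "f (w (Suc k)) = f (w k) + v $ k * f (unit_vec d k)"
      using add[OF wc] smult by simp
    then show ?case using Suc by simp
  qed
  moreover have "w d = v" using v by (intro eq_vecI) (auto simp: w_def)
  ultimately show ?thesis by (metis order_refl)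
qed

text \<open>Restrict the form to the abelian ideal R^d. Closedness on e_0, v, w is the invariance. A
  radical vector of the restriction that also pairs to zero with e_0 is zero by non-degeneracy, so
  the functional \<alpha> embeds the radical into the reals.\<close>

lemma symplectic_imp_admissible:
  assumes A: "A \<in> carrier_mat d d" and sym: "symplectic_structure (almost_abelian A) \<omega>"
  shows "admissible A"
proof -
  have dA [simp]: "dim_row A = d" "dim_col A = d" using A by auto
  let ?V = "carrier_vec d :: real vec set"
  from sym have tf: "two_form (almost_abelian A) \<omega>"
    and nd: "nondegenerate_form (almost_abelian A) \<omega>"
    and cl: "closed_form (almost_abelian A) \<omega>"
    by (auto simp: symplectic_structure_def)
  have addl: "\<omega> (a + b, v + w) z = \<omega> (a, v) z + \<omega> (b, w) z"
    and addr: "\<omega> z (a + b, v + w) = \<omega> z (a, v) + \<omega> z (b, w)"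
    if "v \<in> ?V" "w \<in> ?V" "z \<in> UNIV \<times> ?V" for a b v w z
    using tf that unfolding two_form_def by force+
  have sml: "\<omega> (c * a, c \<cdot>\<^sub>v v) z = c * \<omega> (a, v) z" and smr: "\<omega> z (c * a, c \<cdot>\<^sub>v v) = c * \<omega> z (a, v)"
    if "v \<in> ?V" "z \<in> UNIV \<times> ?V" for a c v z
    using tf that unfolding two_form_def by force+
  have self: "\<omega> z z = 0" if "z \<in> UNIV \<times> ?V" for z
    using tf that unfolding two_form_def by force
  define \<beta> where "\<beta> = (\<lambda>v w. \<omega> (0, v) (0, w))"
  define \<alpha> where "\<alpha> = (\<lambda>v. \<omega> (1, 0\<^sub>v d) (0, v))"
  have \<beta>_add: "\<beta> (v + w) x = \<beta> v x + \<beta> w x" "\<beta> x (v + w) = \<beta> x v + \<beta> x w"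
    if "v \<in> ?V" "w \<in> ?V" "x \<in> ?V" for v w x
    using addl[of v w "(0, x)" 0 0] addr[of v w "(0, x)" 0 0] that by (auto simp: \<beta>_def)
  have \<beta>_smult: "\<beta> (c \<cdot>\<^sub>v v) x = c * \<beta> v x" "\<beta> x (c \<cdot>\<^sub>v v) = c * \<beta> x v"
    if "v \<in> ?V" "x \<in> ?V" for c v x
    using sml[of v "(0, x)" c 0] smr[of v "(0, x)" c 0] that by (auto simp: \<beta>_def)
  have \<alpha>_add: "\<alpha> (v + w) = \<alpha> v + \<alpha> w" if "v \<in> ?V" "w \<in> ?V" for v w
    using addr[of v w "(1, 0\<^sub>v d)" 0 0] that by (auto simp: \<alpha>_def)
  have \<alpha>_smult: "\<alpha> (c \<cdot>\<^sub>v v) = c * \<alpha> v" if "v \<in> ?V" for c v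
    using smr[of v "(1, 0\<^sub>v d)" c 0] that by (auto simp: \<alpha>_def)
  have \<beta>_skew: "\<beta> v w = - \<beta> w v" if "v \<in> ?V" "w \<in> ?V" for v w
  proof -
    have "0 = \<beta> (v + w) (v + w)" using self[of "(0, v + w)"] that by (simp add: \<beta>_def)
    also have "\<dots> = \<beta> v v + \<beta> v w + (\<beta> w v + \<beta> w w)" using \<beta>_add that by simp
    finally show ?thesis using self[of "(0, v)"] self[of "(0, w)"] that by (simp add: \<beta>_def)
  qed
  have \<beta>_inv: "\<beta> (A *\<^sub>v v) w + \<beta> v (A *\<^sub>v w) = 0" if vw: "v \<in> ?V" "w \<in> ?V" for v w
  proof -
    have Av: "A *\<^sub>v v \<in> ?V" "A *\<^sub>v w \<in> ?V" using A vw by auto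
    have "\<omega> (bracket (almost_abelian A) (1, 0\<^sub>v d) (0, v)) (0, w)
        + \<omega> (bracket (almost_abelian A) (0, v) (0, w)) (1, 0\<^sub>v d)
        + \<omega> (bracket (almost_abelian A) (0, w) (1, 0\<^sub>v d)) (0, v) = 0"
      by (rule cl[unfolded closed_form_def, rule_format]) (use vw in simp_all)
    moreover have "bracket (almost_abelian A) (1, 0\<^sub>v d) (0, v) = (0, A *\<^sub>v v)"
      using A Av vw by (auto intro!: eq_vecI)
    moreover have "bracket (almost_abelian A) (0, v) (0, w) = (0, 0 \<cdot>\<^sub>v v)"
      using A Av vw by (auto intro!: eq_vecI)
    moreover have "bracket (almost_abelian A) (0, w) (1, 0\<^sub>v d) = (0, (-1) \<cdot>\<^sub>v (A *\<^sub>v w))"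
      using A Av vw by (auto intro!: eq_vecI)
    moreover have "\<omega> (0, 0 \<cdot>\<^sub>v v) (1, 0\<^sub>v d) = 0"
      using sml[of v "(1, 0\<^sub>v d)" 0 0] vw by simp
    ultimately have "\<beta> (A *\<^sub>v v) w + \<beta> ((-1) \<cdot>\<^sub>v (A *\<^sub>v w)) v = 0"
      by (simp add: \<beta>_def)
    then show ?thesis using \<beta>_smult(1)[OF Av(2) vw(1)] \<beta>_skew[OF vw(1) Av(2)] by simp
  qed
  define B where "B = mat d d (\<lambda>(i, j). \<beta> (unit_vec d i) (unit_vec d j))"
  have B: "B \<in> carrier_mat d d" by (simp add: B_def)
  have Bv: "(B *\<^sub>v v) $ i = \<beta> (unit_vec d i) v" if "v \<in> ?V" "i < d" for v i
  proof -
    have "\<beta> (unit_vec d i) v = (\<Sum>j<d. v $ j * \<beta> (unit_vec d i) (unit_vec d j))"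
      by (rule linear_vec_sum[OF \<beta>_add(2) \<beta>_smult(2)]) (use that in auto)
    then show ?thesis using that by (simp add: B_def scalar_prod_def atLeast0LessThan mult.commute)
  qed
  have \<beta>_0: "\<beta> w v = 0" if "v \<in> ?V" "w \<in> ?V" "B *\<^sub>v v = 0\<^sub>v d" for v w
  proof -
    have "\<beta> w v = (\<Sum>j<d. w $ j * \<beta> (unit_vec d j) v)"
      by (rule linear_vec_sum[OF \<beta>_add(1) \<beta>_smult(1)]) (use that in auto)
    also have "\<dots> = 0" using Bv[OF that(1)] that(3) by (intro sum.neutral) simp
    finally show ?thesis .
  qed
  have kernel0: "v = 0\<^sub>v d" if v: "v \<in> ?V" "B *\<^sub>v v = 0\<^sub>v d" "\<alpha> v = 0" for v
  proof -
    have "\<omega> (0, v) z = 0" if z: "z \<in> UNIV \<times> ?V" for z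
    proof -
      obtain a w where z': "z = (a, w)" "w \<in> ?V" using z by auto
      have a0: "a \<cdot>\<^sub>v 0\<^sub>v d = 0\<^sub>v d" by (intro eq_vecI) auto
      have "\<omega> (a, w) (0, v) = \<omega> (a * 1, a \<cdot>\<^sub>v 0\<^sub>v d) (0, v) + \<omega> (0, w) (0, v)"
        using addl[of "a \<cdot>\<^sub>v 0\<^sub>v d" w "(0, v)" a 0] z' v by (simp add: a0)
      also have "\<dots> = a * \<alpha> v + \<beta> w v"
        using sml[of "0\<^sub>v d" "(0, v)" a 1] v by (simp add: \<alpha>_def \<beta>_def)
      finally have 1: "\<omega> (a, w) (0, v) = 0" using v(3) \<beta>_0[OF v(1) z'(2) v(2)] by simp
      have "0 = \<omega> (0 + a, v + w) (0 + a, v + w)" using self[of "(a, v + w)"] v z' by simp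
      also have "\<dots> = \<omega> (0, v) (0, v) + \<omega> (0, v) (a, w) + (\<omega> (a, w) (0, v) + \<omega> (a, w) (a, w))"
        using addl[of v w "(0 + a, v + w)" 0 a] addr[of v w "(0, v)" 0 a] addr[of v w "(a, w)" 0 a] v z'
        by simp
      also have "\<dots> = \<omega> (0, v) (a, w)"
        using self[of "(0, v)"] self[of "(a, w)"] 1 z'(2) v(1) by simp
      finally show ?thesis using z'(1) by simp
    qed
    then have "(0, v) = \<zero>\<^bsub>almost_abelian A\<^esub>"
      by (intro nd[unfolded nondegenerate_form_def, rule_format]) (use v in simp_all)
    then show ?thesis by simp
  qed
  have "\<exists>u \<in> ?V. \<forall>v \<in> ?V. B *\<^sub>v v = 0\<^sub>v d \<longrightarrow> (\<exists>a. v = a \<cdot>\<^sub>v u)"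
  proof (cases "\<exists>u \<in> ?V. B *\<^sub>v u = 0\<^sub>v d \<and> \<alpha> u \<noteq> 0")
    case True
    then obtain u where u: "u \<in> ?V" "B *\<^sub>v u = 0\<^sub>v d" "\<alpha> u \<noteq> 0" by blast
    have "v = (\<alpha> v / \<alpha> u) \<cdot>\<^sub>v u" if v: "v \<in> ?V" "B *\<^sub>v v = 0\<^sub>v d" for v
    proof -
      \<comment> \<open>Chosen so that \<alpha> vanishes on the combination of \<open>v\<close> and
        \<open>u\<close>, to which \<open>kernel0\<close> then applies.\<close>
      let ?c = "- (\<alpha> v / \<alpha> u)"
      have "?c \<cdot>\<^sub>v 0\<^sub>v d = 0\<^sub>v d" by (intro eq_vecI) auto
      have "v + ?c \<cdot>\<^sub>v u = 0\<^sub>v d"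
      proof (rule kernel0)
        show "B *\<^sub>v (v + ?c \<cdot>\<^sub>v u) = 0\<^sub>v d"
          using mult_add_distrib_mat_vec[OF B v(1), of "?c \<cdot>\<^sub>v u"] mult_mat_vec[OF B u(1), of ?c] u v
            \<open>?c \<cdot>\<^sub>v 0\<^sub>v d = 0\<^sub>v d\<close>
          by simp
        show "\<alpha> (v + ?c \<cdot>\<^sub>v u) = 0"
          using \<alpha>_add[OF v(1), of "?c \<cdot>\<^sub>v u"] \<alpha>_smult[OF u(1), of ?c] u by simp
      qed (use u v in simp)
      then have "(v + ?c \<cdot>\<^sub>v u) $ i = 0" if "i < d" for i using that by simp
      then show ?thesis using u(1) v(1) by (intro eq_vecI) auto
    qed
    with u show ?thesis by blast
  next
    case False
    then have "v = 0 \<cdot>\<^sub>v 0\<^sub>v d" if "v \<in> ?V" "B *\<^sub>v v = 0\<^sub>v d" for v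
      using kernel0[of v] that by auto
    then show ?thesis using zero_carrier_vec by blast
  qed
  then obtain u where u: "u \<in> ?V" "\<And>v. v \<in> ?V \<Longrightarrow> B *\<^sub>v v = 0\<^sub>v d \<Longrightarrow> \<exists>a. v = a \<cdot>\<^sub>v u" by blast
  show ?thesis
  proof (rule admissibleI[OF A B _ _ u])
    show "transpose_mat B = - B"
      by (rule eq_matI) (auto simp: B_def intro: \<beta>_skew)
    show "transpose_mat A * B + B * A = 0\<^sub>m d d"
    proof (rule eq_matI)
      fix i j assume "i < dim_row (0\<^sub>m d d :: real mat)" "j < dim_col (0\<^sub>m d d :: real mat)"
      then have ij: "i < d" "j < d" by simp_all
      let ?e = "unit_vec d :: nat \<Rightarrow> real vec"
      have Ae: "(A *\<^sub>v ?e k) $ l = A $$ (l, k)" "A *\<^sub>v ?e k \<in> ?V" if "k < d" "l < d" for k l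
        using that A by (simp_all add: scalar_prod_right_unit)
      have "(transpose_mat A * B) $$ (i, j) = (\<Sum>k<d. A $$ (k, i) * \<beta> (?e k) (?e j))"
        using ij by (simp add: scalar_prod_def B_def atLeast0LessThan)
      also have "\<dots> = (\<Sum>k<d. (A *\<^sub>v ?e i) $ k * \<beta> (?e k) (?e j))"
        by (rule sum.cong) (use Ae ij in auto)
      also have "\<dots> = \<beta> (A *\<^sub>v ?e i) (?e j)"
        by (rule linear_vec_sum[OF \<beta>_add(1) \<beta>_smult(1), symmetric]) (use Ae ij in auto)
      finally have 1: "(transpose_mat A * B) $$ (i, j) = \<beta> (A *\<^sub>v ?e i) (?e j)" .
      have "(B * A) $$ (i, j) = (\<Sum>k<d. A $$ (k, j) * \<beta> (?e i) (?e k))"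
        using ij by (simp add: scalar_prod_def B_def atLeast0LessThan mult.commute)
      also have "\<dots> = (\<Sum>k<d. (A *\<^sub>v ?e j) $ k * \<beta> (?e i) (?e k))"
        by (rule sum.cong) (use Ae ij in auto)
      also have "\<dots> = \<beta> (?e i) (A *\<^sub>v ?e j)"
        by (rule linear_vec_sum[OF \<beta>_add(2) \<beta>_smult(2), symmetric]) (use Ae ij in auto)
      finally have 2: "(B * A) $$ (i, j) = \<beta> (?e i) (A *\<^sub>v ?e j)" .
      show "(transpose_mat A * B + B * A) $$ (i, j) = 0\<^sub>m d d $$ (i, j)"
        using 1 2 \<beta>_inv[of "?e i" "?e j"] ij B by simp
    qed (use B in simp_all)
  qed
qed

text \<open>Odd dimension forces a nonzero radical vector \<open>w\<close>, which spans the radical.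
  Adding to the form the wedge of the dual of e_0 with the functional x -> w . x removes it, because
  w . w is nonzero.\<close>

lemma admissible_imp_symplectic:
  assumes A: "A \<in> carrier_mat d d" and d: "odd d" and adm: "admissible A"
  shows "\<exists>\<omega>. symplectic_structure (almost_abelian A) \<omega>"
proof -
  have dA [simp]: "dim_row A = d" "dim_col A = d" using A by auto
  let ?V = "carrier_vec d :: real vec set"
  from admissibleE[OF adm A] obtain B u where
    B: "B \<in> carrier_mat d d" and sk: "transpose_mat B = - B"
    and inv: "transpose_mat A * B + B * A = 0\<^sub>m d d" and u: "u \<in> ?V"
    and ker: "\<And>v. v \<in> ?V \<Longrightarrow> B *\<^sub>v v = 0\<^sub>v d \<Longrightarrow> \<exists>a. v = a \<cdot>\<^sub>v u" by blast
  from skew_odd_kernel_mat[OF B d sk] obtain w where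
    w: "w \<in> ?V" "w \<noteq> 0\<^sub>v d" "B *\<^sub>v w = 0\<^sub>v d" by blast
  have ww: "w \<bullet> w \<noteq> 0"
  proof
    assume "w \<bullet> w = 0"
    then have "(\<Sum>i\<in>{0..<d}. w $ i * w $ i) = 0" using w(1) by (simp add: scalar_prod_def)
    then have "\<forall>i\<in>{0..<d}. w $ i * w $ i = 0" by (subst (asm) sum_nonneg_eq_0_iff) auto
    then have "w = 0\<^sub>v d" using w(1) by (intro eq_vecI) auto
    with w(2) show False by simp
  qed
  have line: "\<exists>a. v = a \<cdot>\<^sub>v w" if v: "v \<in> ?V" "B *\<^sub>v v = 0\<^sub>v d" for v
  proof -
    obtain a b where ab: "w = a \<cdot>\<^sub>v u" "v = b \<cdot>\<^sub>v u" using ker w v by meson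
    have "a \<noteq> 0"
    proof
      assume "a = 0"
      then have "w = 0\<^sub>v d" unfolding ab(1) using u by (intro eq_vecI) auto
      with w show False by simp
    qed
    then have "v = (b / a) \<cdot>\<^sub>v w" unfolding ab using u by (intro eq_vecI) auto
    then show ?thesis ..
  qed
  define \<beta> where "\<beta> = (\<lambda>v x. v \<bullet> (B *\<^sub>v x))"
  have Bc: "B *\<^sub>v x \<in> ?V" if "x \<in> ?V" for x using B that by simp
  have Ac: "A *\<^sub>v x \<in> ?V" if "x \<in> ?V" for x using A that by simp
  have \<beta>_add: "\<beta> (v + x) y = \<beta> v y + \<beta> x y" "\<beta> y (v + x) = \<beta> y v + \<beta> y x"
    if "v \<in> ?V" "x \<in> ?V" "y \<in> ?V" for v x y
    using that Bc B
    by (simp_all add: \<beta>_def add_scalar_prod_distrib[of _ d] mult_add_distrib_mat_vec[of _ d d]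
        scalar_prod_add_distrib[of _ d])
  have \<beta>_smult: "\<beta> (c \<cdot>\<^sub>v v) y = c * \<beta> v y" "\<beta> y (c \<cdot>\<^sub>v v) = c * \<beta> y v"
    if "v \<in> ?V" "y \<in> ?V" for c v y
    using that Bc[of v] Bc[of y] by (simp_all add: \<beta>_def mult_mat_vec[OF B])
  have \<beta>_skew: "\<beta> v x = - \<beta> x v" if "v \<in> ?V" "x \<in> ?V" for v x
  proof -
    have "\<beta> v x = (transpose_mat B *\<^sub>v v) \<bullet> x"
      unfolding \<beta>_def using transpose_vec_mult_scalar[OF B that(2,1)] by simp
    also have "\<dots> = - ((B *\<^sub>v v) \<bullet> x)"
      unfolding sk using B Bc[OF that(1)] that by simp
    also have "(B *\<^sub>v v) \<bullet> x = \<beta> x v"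
      unfolding \<beta>_def by (rule comm_scalar_prod[OF Bc[OF that(1)] that(2)])
    finally show ?thesis .
  qed
  have \<beta>_inv: "\<beta> (A *\<^sub>v v) x = - \<beta> v (A *\<^sub>v x)" if "v \<in> ?V" "x \<in> ?V" for v x
  proof -
    have "\<beta> (A *\<^sub>v v) x = (B *\<^sub>v x) \<bullet> (A *\<^sub>v v)"
      unfolding \<beta>_def by (rule comm_scalar_prod[OF Ac[OF that(1)] Bc[OF that(2)]])
    also have "\<dots> = (transpose_mat A *\<^sub>v (B *\<^sub>v x)) \<bullet> v"
      by (rule transpose_vec_mult_scalar[OF A that(1) Bc[OF that(2)], symmetric])
    also have "\<dots> = v \<bullet> (transpose_mat A *\<^sub>v (B *\<^sub>v x))"
      using A Bc[OF that(2)] that by (intro comm_scalar_prod[of _ d]) auto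
    finally have 1: "\<beta> (A *\<^sub>v v) x = v \<bullet> ((transpose_mat A * B) *\<^sub>v x)"
      using A B that by simp
    have "v \<bullet> ((transpose_mat A * B + B * A) *\<^sub>v x)
        = v \<bullet> ((transpose_mat A * B) *\<^sub>v x) + v \<bullet> ((B * A) *\<^sub>v x)"
      using A B that by (subst add_mult_distrib_mat_vec[of _ d d])
        (auto intro!: scalar_prod_add_distrib[of _ d])
    moreover have "v \<bullet> ((transpose_mat A * B + B * A) *\<^sub>v x) = 0"
      unfolding inv using that by (simp add: scalar_prod_def)
    ultimately show ?thesis unfolding 1 using A B that by (simp add: \<beta>_def)
  qed
  define \<omega> :: "real \<times> real vec \<Rightarrow> real \<times> real vec \<Rightarrow> real" where
    "\<omega> = (\<lambda>(a, v) (b, x). \<beta> v x + a * (w \<bullet> x) - b * (w \<bullet> v))"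
  have \<omega>: "\<omega> (a, v) (b, x) = \<beta> v x + a * (w \<bullet> x) - b * (w \<bullet> v)" for a b v x
    by (simp add: \<omega>_def)
  have "two_form (almost_abelian A) \<omega>"
    unfolding two_form_def
  proof (intro conjI ballI allI)
    fix x y z :: "real \<times> real vec" and c :: real
    assume xy: "x \<in> carrier (almost_abelian A)" "y \<in> carrier (almost_abelian A)"
    obtain a v b v' where x: "x = (a, v)" "y = (b, v')" "v \<in> ?V" "v' \<in> ?V" using xy by auto
    show "\<omega> (c \<odot>\<^bsub>almost_abelian A\<^esub> x) y = c * \<omega> x y"
      and "\<omega> x (c \<odot>\<^bsub>almost_abelian A\<^esub> y) = c * \<omega> x y"
      using x w \<beta>_smult by (simp_all add: \<omega> algebra_simps)
    assume z: "z \<in> carrier (almost_abelian A)"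
    obtain e v'' where z': "z = (e, v'')" "v'' \<in> ?V" using z by auto
    show "\<omega> (x \<oplus>\<^bsub>almost_abelian A\<^esub> y) z = \<omega> x z + \<omega> y z"
      and "\<omega> x (y \<oplus>\<^bsub>almost_abelian A\<^esub> z) = \<omega> x y + \<omega> x z"
      using x z' w \<beta>_add by (simp_all add: \<omega> algebra_simps scalar_prod_add_distrib[of _ d])
  next
    fix x assume "x \<in> carrier (almost_abelian A)"
    then obtain a v where x: "x = (a, v)" "v \<in> ?V" by auto
    then show "\<omega> x x = 0" using \<beta>_skew[of v v] by (simp add: \<omega>)
  qed
  moreover have "nondegenerate_form (almost_abelian A) \<omega>"
    unfolding nondegenerate_form_def
  proof (intro ballI impI)
    fix x assume "x \<in> carrier (almost_abelian A)"
      and z: "\<forall>y\<in>carrier (almost_abelian A). \<omega> x y = 0"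
    then obtain a v where x: "x = (a, v)" and v: "v \<in> ?V" by auto
    \<comment> \<open>Testing against e_0 gives \<open>w \<bullet> v = 0\<close>, against
      \<open>w\<close> gives \<open>a = 0\<close>, and against the basis vectors puts
      \<open>v\<close> into the radical, hence on the line of \<open>w\<close>.\<close>
    have z': "\<beta> v y + a * (w \<bullet> y) - b * (w \<bullet> v) = 0" if "y \<in> ?V" for b y
      using z that by (auto simp: x \<omega>)
    have "B *\<^sub>v 0\<^sub>v d = 0\<^sub>v d" using B by (intro eq_vecI) auto
    then have "\<beta> v (0\<^sub>v d) = 0" using v by (simp add: \<beta>_def)
    then have wv: "w \<bullet> v = 0" using z'[of "0\<^sub>v d" 1] w by simp
    have "\<beta> v w = 0" using w v by (simp add: \<beta>_def)
    then have a: "a = 0" using z'[of w 0] w ww by simp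
    have "B *\<^sub>v v = 0\<^sub>v d"
    proof (rule eq_vecI)
      fix i assume "i < dim_vec (0\<^sub>v d :: real vec)"
      then have i: "i < d" by simp
      have "\<beta> (unit_vec d i) v = 0"
        using z'[of "unit_vec d i" 0] \<beta>_skew[of v "unit_vec d i"] v a by simp
      then show "(B *\<^sub>v v) $ i = 0\<^sub>v d $ i"
        using i Bc[OF v] by (simp add: \<beta>_def scalar_prod_left_unit[of _ d])
    qed (use B in simp)
    from line[OF v this] obtain e where e: "v = e \<cdot>\<^sub>v w" by blast
    with wv w ww have "e = 0" by simp
    then have "v = 0\<^sub>v d" unfolding e using w by (intro eq_vecI) auto
    then show "x = \<zero>\<^bsub>almost_abelian A\<^esub>" by (simp add: x a)
  qed
  moreover have "closed_form (almost_abelian A) \<omega>"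
    unfolding closed_form_def
  proof (intro ballI)
    fix x y z assume "x \<in> carrier (almost_abelian A)" "y \<in> carrier (almost_abelian A)"
      "z \<in> carrier (almost_abelian A)"
    then obtain a b c p q r where xyz: "x = (a, p)" "y = (b, q)" "z = (c, r)"
      and V: "p \<in> ?V" "q \<in> ?V" "r \<in> ?V" by auto
    have br: "\<omega> (bracket (almost_abelian A) (a, p) (b, q)) (c, r)
        = a * \<beta> (A *\<^sub>v q) r - b * \<beta> (A *\<^sub>v p) r
          - c * (a * (w \<bullet> (A *\<^sub>v q)) - b * (w \<bullet> (A *\<^sub>v p)))"
      if V: "p \<in> ?V" "q \<in> ?V" "r \<in> ?V" for a b c p q r
    proof -
      have "a \<cdot>\<^sub>v (A *\<^sub>v q) - b \<cdot>\<^sub>v (A *\<^sub>v p) = a \<cdot>\<^sub>v (A *\<^sub>v q) + (- b) \<cdot>\<^sub>v (A *\<^sub>v p)"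
        using Ac[OF V(1)] Ac[OF V(2)] by (intro eq_vecI) auto
      then show ?thesis
        using Ac[OF V(1)] Ac[OF V(2)] V w
        by (simp add: \<omega> \<beta>_add \<beta>_smult scalar_prod_add_distrib[of _ d])
    qed
    \<comment> \<open>The terms with \<open>w\<close> cancel in the cyclic sum; the coefficient of
      each e_0-component is an instance of the invariance of \<beta>.\<close>
    show "\<omega> (bracket (almost_abelian A) x y) z + \<omega> (bracket (almost_abelian A) y z) x
        + \<omega> (bracket (almost_abelian A) z x) y = 0"
      unfolding xyz br[OF V] br[OF V(2,3,1)] br[OF V(3,1,2)]
      using \<beta>_inv[OF V(1,2)] \<beta>_inv[OF V(2,3)] \<beta>_inv[OF V(3,1)]
        \<beta>_skew[OF V(1) Ac[OF V(2)]] \<beta>_skew[OF V(2) Ac[OF V(3)]] \<beta>_skew[OF V(3) Ac[OF V(1)]]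
      by (simp add: algebra_simps)
  qed
  ultimately show ?thesis unfolding symplectic_structure_def by blast
qed

section \<open>Jordan types\<close>

lemma jordan_sum_ones: "jordan_sum (replicate t 1) = 0\<^sub>m t t"
proof (induction t)
  case 0
  then show ?case by (simp add: jordan_sum_def)
next
  case (Suc t)
  have "nil_jordan_block 1 = 0\<^sub>m 1 1" by (rule eq_matI) (auto simp: nil_jordan_block_def)
  then have "jordan_sum ([1] @ replicate t 1) = 0\<^sub>m (1 + t) (1 + t)"
    unfolding jordan_sum_append jordan_sum_single Suc by (simp add: sum_list_replicate)
  then show ?case by simp
qed

text \<open>One inner list per size, so that all blocks of one size form a single summand in
  \<open>admissible_concat\<close>; the zero block becomes \<open>t\<close> ones.\<close>

definition block_sizes :: "nat \<Rightarrow> (nat \<Rightarrow> nat) \<Rightarrow> (nat \<Rightarrow> nat) \<Rightarrow> nat \<Rightarrow> nat list list" where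
  "block_sizes k ns ps t = map (\<lambda>i. replicate (ps i) (ns i)) [1..<Suc k] @ [replicate t 1]"

lemma nil_jordan_form_eq_jordan_sum:
  "nil_jordan_form k ns ps t = jordan_sum (concat (block_sizes k ns ps t))"
proof -
  have "map nil_jordan_block (concat (map (\<lambda>i. replicate (ps i) (ns i)) [1..<Suc k]))
      = concat (map (\<lambda>i. replicate (ps i) (nil_jordan_block (ns i))) [1..<Suc k])"
    by (simp add: map_concat comp_def del: upt_Suc)
  moreover have "diag_block_mat [0\<^sub>m t t] = diag_block_mat (map nil_jordan_block (replicate t 1))"
    using jordan_sum_ones[of t] unfolding jordan_sum_def diag_block_mat_singleton by simp
  ultimately show ?thesis
    unfolding nil_jordan_form_def jordan_sum_def block_sizes_def concat_append map_append
      diag_block_mat_append concat.simps append_Nil2 by (simp only:)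
qed

lemma sum_list_upt_Suc: "(\<Sum>i\<leftarrow>[Suc 0..<Suc k]. f i) = (\<Sum>i = Suc 0..k. f i :: nat)"
  by (simp add: interv_sum_list_conv_sum_set_nat atLeastLessThanSuc_atLeastAtMost del: upt_Suc)

lemma count_list_replicate: "count_list (replicate p x) y = (if x = y then p else 0)"
  by (induction p) auto

lemma count_list_concat: "count_list (concat xss) x = (\<Sum>xs\<leftarrow>xss. count_list xs x)"
  by (induction xss) auto

lemma count_block_sizes:
  "count_list (concat (block_sizes k ns ps t)) s
    = (\<Sum>i = 1..k. if ns i = s then ps i else 0) + (if s = 1 then t else 0)"
  unfolding count_list_concat block_sizes_def
  by (simp add: count_list_replicate comp_def sum_list_upt_Suc del: upt_Suc)

theorem theorem5p10:
  fixes n k t :: nat and M :: "real mat" and ns ps :: "nat \<Rightarrow> nat"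
  assumes "1 \<le> n"
    and "M \<in> carrier_mat (2 * n - 1) (2 * n - 1)"
    and "nilpotent_mat M"
    and "nil_type M k ns ps t"
  shows "(\<exists>\<omega>. symplectic_structure (almost_abelian M) \<omega>) \<longleftrightarrow>
    (odd t \<and> (\<forall>i\<in>{1..k}. odd (ns i) \<longrightarrow> even (ps i))) \<or>
    (even t \<and> (\<exists>!l. l \<in> {1..k} \<and> odd (ns l) \<and> odd (ps l)))"
proof -
  let ?d = "2 * n - 1" and ?bs = "block_sizes k ns ps t"
  define P where "P = (\<lambda>i. odd (ns i) \<and> odd (ps i))"
  have M: "M \<in> carrier_mat ?d ?d" and d: "odd ?d" using assms by auto
  from assms(4) have dec: "\<And>i j. i \<in> {1..k} \<Longrightarrow> j \<in> {1..k} \<Longrightarrow> i < j \<Longrightarrow> ns j < ns i"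
    and ge2: "\<And>i. i \<in> {1..k} \<Longrightarrow> 2 \<le> ns i"
    and dim: "(\<Sum>i=1..k. ns i * ps i) + t = ?d"
    and sim: "similar_mat M (jordan_sum (concat ?bs))"
    using M unfolding nil_type_def nil_jordan_form_eq_jordan_sum by auto
  \<comment> \<open>Distinct sizes ensure that the multiplicity of \<open>ns i\<close> in the list
    is exactly \<open>ps i\<close>; as all are at least 2, that of size 1 is exactly
    \<open>t\<close>.\<close>
  have inj: "i = j" if "i \<in> {1..k}" "j \<in> {1..k}" "ns i = ns j" for i j
    using dec[of i j] dec[of j i] that by (metis less_irrefl linorder_neqE_nat)
  have count_ns: "count_list (concat ?bs) (ns i) = ps i" if i: "i \<in> {1..k}" for i
  proof -
    have "(\<Sum>j = 1..k. if ns j = ns i then ps j else 0) = (\<Sum>j = 1..k. if j = i then ps j else 0)"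
      by (rule sum.cong) (use inj i in auto)
    also have "\<dots> = ps i" using i by simp
    finally show ?thesis using ge2[OF i] unfolding count_block_sizes by simp
  qed
  have count_1: "count_list (concat ?bs) 1 = t"
  proof -
    have "(\<Sum>j = 1..k. if ns j = 1 then ps j else 0) = 0"
      by (rule sum.neutral) (use ge2 in fastforce)
    then show ?thesis unfolding count_block_sizes by simp
  qed
  have "(\<exists>\<omega>. symplectic_structure (almost_abelian M) \<omega>) \<longleftrightarrow> admissible (jordan_sum (concat ?bs))"
    using symplectic_imp_admissible[OF M] admissible_imp_symplectic[OF M d]
      admissible_similar sim similar_mat_sym by blast
  also have "\<dots> \<longleftrightarrow> (odd t \<and> (\<forall>i\<in>{1..k}. \<not> P i)) \<or> (even t \<and> (\<exists>!l. l \<in> {1..k} \<and> P l))"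
    (is "_ \<longleftrightarrow> ?C")
  proof
    assume adm: "admissible (jordan_sum (concat ?bs))"
    note unique = admissible_odd_count_unique[OF adm]
    show ?C
    proof (cases "odd t")
      case True
      \<comment> \<open>Size 1 already is an odd size of odd multiplicity \<open>t\<close>, and
        there is only one such size.\<close>
      have "\<not> P i" if i: "i \<in> {1..k}" for i
      proof
        assume "P i"
        then have "ns i = 1"
          using unique[of "ns i" 1] True by (simp add: P_def count_ns[OF i] count_1[simplified])
        with ge2[OF i] show False by simp
      qed
      with True show ?thesis by blast
    next
      case False
      \<comment> \<open>Existence comes from the dimension: the total is odd and \<open>t\<close>
        even, so some product \<open>ns l * ps l\<close> is odd.\<close>
      have "\<exists>l\<in>{1..k}. P l"
      proof (rule ccontr)
        assume "\<not> ?thesis"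
        then have "even (\<Sum>i=1..k. ns i * ps i)" by (intro dvd_sum) (auto simp: P_def)
        with False dim d show False by (metis even_add)
      qed
      moreover have "l = l'" if "l \<in> {1..k}" "P l" "l' \<in> {1..k}" "P l'" for l l'
        using unique[of "ns l" "ns l'"] inj[OF that(1,3)] that by (simp add: P_def count_ns)
      ultimately have "\<exists>!l. l \<in> {1..k} \<and> P l" by blast
      with False show ?thesis by blast
    qed
  next
    assume C: ?C
    \<comment> \<open>The groups of odd total size are those with \<open>P i\<close>, together with
      the ones if \<open>t\<close> is odd. Either condition leaves at most one such group.\<close>
    have "length (filter P [1..<Suc k]) = card {i \<in> {1..k}. P i}"
      using distinct_length_filter[of "[1..<Suc k]" P]
      by (simp add: Int_def conj_commute atLeastLessThanSuc_atLeastAtMost del: upt_Suc)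
    also have "\<dots> + (if odd t then 1 else 0) \<le> 1"
    proof (cases "odd t")
      case True
      then have "{i \<in> {1..k}. P i} = {}" using C by blast
      then show ?thesis by (simp del: Collect_empty_eq)
    next
      case False
      then obtain l where "{i \<in> {1..k}. P i} = {l}" using C by blast
      then show ?thesis using False by simp
    qed
    finally have "length (filter P [1..<Suc k]) + (if odd t then 1 else 0) \<le> 1" .
    moreover have "odd (sum_list (replicate (ps i) (ns i))) \<longleftrightarrow> P i" for i
      by (auto simp: P_def sum_list_replicate)
    ultimately have "length (filter (\<lambda>ms. odd (sum_list ms)) ?bs) \<le> 1"
      by (auto simp: block_sizes_def filter_map comp_def sum_list_replicate simp del: upt_Suc)
    moreover have "\<forall>ms \<in> set ?bs. admissible (jordan_sum ms)"
      by (auto simp: block_sizes_def intro: admissible_replicate[of _ 1, simplified] admissible_replicate)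
    ultimately show "admissible (jordan_sum (concat ?bs))" by (intro admissible_concat)
  qed
  finally show ?thesis unfolding P_def by blast
qed

end
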